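(* Let $(W,S)$ be a Coxeter system with $S$ finite and root system $\Phi$. Let $W'$ be a dihedral reflection subgroup of $W$, and let $\gamma,\delta\in\Phi^+_{W'}$. (1) If $W'$ is infinite and $\ell_{W'}(s_\gamma)<\ell_{W'}(s_\delta)$, then $\operatorname{dp}_\infty(\gamma)<\operatorname{dp}_\infty(\delta)$. (2) If $W'$ is finite and there exists $x\in W'$ such that $\delta=x(\gamma)$ and $\ell_{W'}(s_\delta)=\ell_{W'}(s_\gamma)+2\ell_{W'}(x)$, then $\operatorname{dp}_\infty(\gamma)\le\operatorname{dp}_\infty(\delta)$.
   Context: Geometric representation and roots. Fix a geometric representation of $(W,S)$: a real vector space $V$ with a symmetric bilinear form $B$, and a simple system $\Delta=\{\alpha_s : s\in S\}\subseteq V$ (finite, indexed bijectively by $S$) such that: $\sum_{\alpha\in\Delta}a_\alpha\alpha=0$ with all $a_\alpha\ge 0$ implies all $a_\alpha=0$; $B(\alpha,\beta)\in\,]-\infty,-1]\cup\{-\cos(\pi/k): k\in\mathbb N, k\geq 2\}$ for distinct $\alpha,\beta\in\Delta$; $B(\alpha,\alpha)=1$ for $\alpha\in\Delta$; and $W$ is faithfully represented in the group of linear maps preserving $B$, with $s\in S$ acting by $v\mapsto v-2B(\alpha_s,v)\alpha_s$. (So $B(\alpha_s,\alpha_t)=-\cos(\pi/m_{st})$ if the order $m_{st}$ of $st$ is finite, and $B(\alpha_s,\alpha_t)\le -1$ iff $m_{st}=\infty$.) The root system is $\Phi=W(\Delta)$; $\Phi^+$ is the set of roots that are non-negative linear combinations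 of $\Delta$, $\Phi^-=-\Phi^+$, and $\Phi=\Phi^+\sqcup\Phi^-$. For $\beta\in\Phi$, $s_\beta\in W$ is the reflection $v\mapsto v-2B(\beta,v)\beta$. The (left) inversion set of $w\in W$ is $N(w)=\Phi^+\cap w(\Phi^-)$. Dominance and $\infty$-depth. For $\alpha,\beta\in\Phi^+$, write $\alpha\preceq\beta$ if for all $w\in W$, $\beta\in N(w)$ implies $\alpha\in N(w)$; write $\alpha\prec\beta$ if moreover $\alpha\neq\beta$. The $\infty$-depth of $\beta\in\Phi^+$ is $\operatorname{dp}_\infty(\beta)=|\{\alpha\in\Phi^+ : \alpha\prec\beta\}|$. Reflection subgroups. For a reflection subgroup $W'$ of $W$ (a subgroup generated by reflections $s_\beta$, $\beta\in\Phi$), put $\Phi_{W'}=\{\beta\in\Phi: s_\beta\in W'\}$, $\Phi_{W'}^+=\Phi_{W'}\cap\Phi^+$, and $\Delta_{W'}=\{\alpha\in\Phi^+: N(s_\alpha)\cap\Phi_{W'}=\{\alpha\}\}$ (canonical simple system). Then $(W',S')$ with $S'=\{s_\alpha:\alpha\in\Delta_{W'}\}$ is a Coxeter system, and $\ell_{W'}$ denotes its length function. $W'$ is dihedral if $|\Delta_{W'}|=2$. *)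

theory Defs
  imports
    "HOL-Analysis.Linear_Algebra"
    "HOL-Algebra.Generated_Groups"
    "HOL-Algebra.Multiplicative_Group"
    "HOL-Algebra.Group_Action"
begin

section \<open>Coxeter systems\<close>

definition word_val :: "('g, 'm) monoid_scheme \<Rightarrow> 'g list \<Rightarrow> 'g" where
  "word_val G ws = foldr (mult G) ws (one G)"

text \<open>
  The congruence on words over \<open>S\<close> generated by the relations \<open>(st)^m = 1\<close>, where \<open>m\<close> is the order
  of \<open>st\<close>.  Elements of infinite order have \<open>ord = 0\<close>, so such pairs contribute only a
  trivial relation.  For \<open>s = t\<close> of order 2 the relator is \<open>[s, s]\<close>; hence words in the letters
  \<open>S\<close> alone, without formal inverses, already describe the presented group.
\<close>

inductive coxeter_word_eq :: "('g, 'm) monoid_scheme \<Rightarrow> 'g set \<Rightarrow> 'g list \<Rightarrow> 'g list \<Rightarrow> bool"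
  for G S where
  refl: "coxeter_word_eq G S us us"
| sym: "coxeter_word_eq G S us vs \<Longrightarrow> coxeter_word_eq G S vs us"
| trans: "coxeter_word_eq G S us vs \<Longrightarrow> coxeter_word_eq G S vs ws \<Longrightarrow> coxeter_word_eq G S us ws"
| relator: "us \<in> lists S \<Longrightarrow> vs \<in> lists S \<Longrightarrow> s \<in> S \<Longrightarrow> t \<in> S \<Longrightarrow>
    coxeter_word_eq G S
      (us @ concat (replicate (group.ord G (s \<otimes>\<^bsub>G\<^esub> t)) [s, t]) @ vs) (us @ vs)"

locale coxeter_system = group G for G (structure) +
  fixes S :: "'a set"
  assumes S_subset: "S \<subseteq> carrier G"
    and S_generates: "generate G S = carrier G"
    and S_order_two: "s \<in> S \<Longrightarrow> ord s = 2"
    and presentation: "ws \<in> lists S \<Longrightarrow> word_val G ws = \<one> \<Longrightarrow> coxeter_word_eq G S ws []"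

text \<open>Used only for sets \<open>X\<close> of involutions, so no inverses of letters are needed.\<close>

definition word_length :: "('g, 'm) monoid_scheme \<Rightarrow> 'g set \<Rightarrow> 'g \<Rightarrow> nat" where
  "word_length G X w = (LEAST n. \<exists>ws \<in> lists X. length ws = n \<and> word_val G ws = w)"


section \<open>Geometric representations and roots\<close>

definition reflection :: "('v \<Rightarrow> 'v \<Rightarrow> real) \<Rightarrow> 'v \<Rightarrow> 'v \<Rightarrow> 'v::real_vector" where
  "reflection B \<beta> v = v - (2 * B \<beta> v) *\<^sub>R \<beta>"

text \<open>
  \<open>V\<close> is the whole type \<open>'v\<close>, \<open>\<phi>\<close> is the representation and \<open>\<alpha> s\<close> is the simple root of \<open>s\<close>.
\<close>

locale geometric_representation =
  faithful_action G UNIV \<phi>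
  for G (structure) and \<phi> :: "'a \<Rightarrow> 'v \<Rightarrow> 'v::real_vector" +
  fixes S :: "'a set" and B :: "'v \<Rightarrow> 'v \<Rightarrow> real" and \<alpha> :: "'a \<Rightarrow> 'v"
  assumes B_bilinear: "bilinear B"
    and B_symmetric: "B u v = B v u"
    and S_finite: "finite S"
    and simple_inj: "inj_on \<alpha> S"
    and simple_positively_independent:
      "(\<And>s. s \<in> S \<Longrightarrow> a s \<ge> 0) \<Longrightarrow> (\<Sum>s\<in>S. a s *\<^sub>R \<alpha> s) = 0 \<Longrightarrow> s \<in> S \<Longrightarrow> a s = 0"
    and simple_norm: "s \<in> S \<Longrightarrow> B (\<alpha> s) (\<alpha> s) = 1"
    and simple_product: "s \<in> S \<Longrightarrow> t \<in> S \<Longrightarrow> s \<noteq> t \<Longrightarrow>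
      B (\<alpha> s) (\<alpha> t) \<in> {..-1} \<union> {- cos (pi / real k) | k :: nat. k \<ge> 2}"
    and action_linear: "w \<in> carrier G \<Longrightarrow> linear (\<phi> w)"
    and action_preserves_B: "w \<in> carrier G \<Longrightarrow> B (\<phi> w u) (\<phi> w v) = B u v"
    and action_simple: "s \<in> S \<Longrightarrow> \<phi> s = reflection B (\<alpha> s)"

definition roots ::
  "('g, 'm) monoid_scheme \<Rightarrow> ('g \<Rightarrow> 'v \<Rightarrow> 'v::real_vector) \<Rightarrow> 'g set \<Rightarrow> ('g \<Rightarrow> 'v) \<Rightarrow> 'v set" where
  "roots G \<phi> S \<alpha> = {\<phi> w (\<alpha> s) | w s. w \<in> carrier G \<and> s \<in> S}"

definition pos_roots ::
  "('g, 'm) monoid_scheme \<Rightarrow> ('g \<Rightarrow> 'v \<Rightarrow> 'v::real_vector) \<Rightarrow> 'g set \<Rightarrow> ('g \<Rightarrow> 'v) \<Rightarrow> 'v set" where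
  "pos_roots G \<phi> S \<alpha> =
    {\<beta> \<in> roots G \<phi> S \<alpha>. \<exists>a. (\<forall>s\<in>S. a s \<ge> 0) \<and> \<beta> = (\<Sum>s\<in>S. a s *\<^sub>R \<alpha> s)}"

definition neg_roots ::
  "('g, 'm) monoid_scheme \<Rightarrow> ('g \<Rightarrow> 'v \<Rightarrow> 'v::real_vector) \<Rightarrow> 'g set \<Rightarrow> ('g \<Rightarrow> 'v) \<Rightarrow> 'v set" where
  "neg_roots G \<phi> S \<alpha> = uminus ` pos_roots G \<phi> S \<alpha>"

text \<open>The group element \<open>s\<^sub>\<beta>\<close>; it is unique because \<open>\<phi>\<close> is faithful.\<close>

definition root_reflection ::
  "('g, 'm) monoid_scheme \<Rightarrow> ('g \<Rightarrow> 'v \<Rightarrow> 'v::real_vector) \<Rightarrow> ('v \<Rightarrow> 'v \<Rightarrow> real) \<Rightarrow> 'v \<Rightarrow> 'g" where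
  "root_reflection G \<phi> B \<beta> = (THE w. w \<in> carrier G \<and> \<phi> w = reflection B \<beta>)"

definition inversion_set ::
  "('g, 'm) monoid_scheme \<Rightarrow> ('g \<Rightarrow> 'v \<Rightarrow> 'v::real_vector) \<Rightarrow> 'g set \<Rightarrow> ('g \<Rightarrow> 'v) \<Rightarrow> 'g \<Rightarrow> 'v set" where
  "inversion_set G \<phi> S \<alpha> w = pos_roots G \<phi> S \<alpha> \<inter> \<phi> w ` neg_roots G \<phi> S \<alpha>"


section \<open>Dominance and infinity-depth\<close>

definition dominated_by ::
  "('g, 'm) monoid_scheme \<Rightarrow> ('g \<Rightarrow> 'v \<Rightarrow> 'v::real_vector) \<Rightarrow> 'g set \<Rightarrow> ('g \<Rightarrow> 'v) \<Rightarrow>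
    'v \<Rightarrow> 'v \<Rightarrow> bool" where
  "dominated_by G \<phi> S \<alpha> \<gamma> \<beta> \<longleftrightarrow>
    (\<forall>w\<in>carrier G. \<beta> \<in> inversion_set G \<phi> S \<alpha> w \<longrightarrow> \<gamma> \<in> inversion_set G \<phi> S \<alpha> w)"

text \<open>
  Since \<open>\<beta> \<in> N(s\<^sub>\<beta>)\<close>, every root dominated by a positive root \<open>\<beta>\<close> lies in the finite set \<open>N(s\<^sub>\<beta>)\<close>,
  so the convention that infinite sets have \<open>card\<close> 0 plays no role here.
\<close>

definition inf_depth ::
  "('g, 'm) monoid_scheme \<Rightarrow> ('g \<Rightarrow> 'v \<Rightarrow> 'v::real_vector) \<Rightarrow> 'g set \<Rightarrow> ('g \<Rightarrow> 'v) \<Rightarrow> 'v \<Rightarrow> nat" where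
  "inf_depth G \<phi> S \<alpha> \<beta> =
    card {\<gamma> \<in> pos_roots G \<phi> S \<alpha>. dominated_by G \<phi> S \<alpha> \<gamma> \<beta> \<and> \<gamma> \<noteq> \<beta>}"


section \<open>Reflection subgroups\<close>

definition reflection_subgroup ::
  "('g, 'm) monoid_scheme \<Rightarrow> ('g \<Rightarrow> 'v \<Rightarrow> 'v::real_vector) \<Rightarrow> 'g set \<Rightarrow> ('v \<Rightarrow> 'v \<Rightarrow> real) \<Rightarrow>
    ('g \<Rightarrow> 'v) \<Rightarrow> 'g set \<Rightarrow> bool" where
  "reflection_subgroup G \<phi> S B \<alpha> W' \<longleftrightarrow>
    (\<exists>R \<subseteq> roots G \<phi> S \<alpha>. W' = generate G (root_reflection G \<phi> B ` R))"

definition sub_roots ::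
  "('g, 'm) monoid_scheme \<Rightarrow> ('g \<Rightarrow> 'v \<Rightarrow> 'v::real_vector) \<Rightarrow> 'g set \<Rightarrow> ('v \<Rightarrow> 'v \<Rightarrow> real) \<Rightarrow>
    ('g \<Rightarrow> 'v) \<Rightarrow> 'g set \<Rightarrow> 'v set" where
  "sub_roots G \<phi> S B \<alpha> W' = {\<beta> \<in> roots G \<phi> S \<alpha>. root_reflection G \<phi> B \<beta> \<in> W'}"

definition sub_pos_roots ::
  "('g, 'm) monoid_scheme \<Rightarrow> ('g \<Rightarrow> 'v \<Rightarrow> 'v::real_vector) \<Rightarrow> 'g set \<Rightarrow> ('v \<Rightarrow> 'v \<Rightarrow> real) \<Rightarrow>
    ('g \<Rightarrow> 'v) \<Rightarrow> 'g set \<Rightarrow> 'v set" where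
  "sub_pos_roots G \<phi> S B \<alpha> W' = sub_roots G \<phi> S B \<alpha> W' \<inter> pos_roots G \<phi> S \<alpha>"

definition sub_simple_roots ::
  "('g, 'm) monoid_scheme \<Rightarrow> ('g \<Rightarrow> 'v \<Rightarrow> 'v::real_vector) \<Rightarrow> 'g set \<Rightarrow> ('v \<Rightarrow> 'v \<Rightarrow> real) \<Rightarrow>
    ('g \<Rightarrow> 'v) \<Rightarrow> 'g set \<Rightarrow> 'v set" where
  "sub_simple_roots G \<phi> S B \<alpha> W' =
    {\<beta> \<in> pos_roots G \<phi> S \<alpha>.
      inversion_set G \<phi> S \<alpha> (root_reflection G \<phi> B \<beta>) \<inter> sub_roots G \<phi> S B \<alpha> W' = {\<beta>}}"

definition sub_length ::
  "('g, 'm) monoid_scheme \<Rightarrow> ('g \<Rightarrow> 'v \<Rightarrow> 'v::real_vector) \<Rightarrow> 'g set \<Rightarrow> ('v \<Rightarrow> 'v \<Rightarrow> real) \<Rightarrow>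
    ('g \<Rightarrow> 'v) \<Rightarrow> 'g set \<Rightarrow> 'g \<Rightarrow> nat" where
  "sub_length G \<phi> S B \<alpha> W' =
    word_length G (root_reflection G \<phi> B ` sub_simple_roots G \<phi> S B \<alpha> W')"

definition dihedral_reflection_subgroup ::
  "('g, 'm) monoid_scheme \<Rightarrow> ('g \<Rightarrow> 'v \<Rightarrow> 'v::real_vector) \<Rightarrow> 'g set \<Rightarrow> ('v \<Rightarrow> 'v \<Rightarrow> real) \<Rightarrow>
    ('g \<Rightarrow> 'v) \<Rightarrow> 'g set \<Rightarrow> bool" where
  "dihedral_reflection_subgroup G \<phi> S B \<alpha> W' \<longleftrightarrow>
    reflection_subgroup G \<phi> S B \<alpha> W' \<and> card (sub_simple_roots G \<phi> S B \<alpha> W') = 2"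

end

theory Submission
  imports Defs
begin

text \<open>
  For arbitrary roots, let \<open>\<beta>\<close> dominate \<open>\<eta>\<close> if every \<open>w \<in> W\<close> with \<open>w \<beta> < 0\<close> has \<open>w \<eta> < 0\<close>.  In
  this form dominance is invariant under \<open>W\<close>, so a reflection \<open>s\<^sub>a\<close> maps the roots dominated by \<open>\<gamma>\<close>
  to those dominated by \<open>s\<^sub>a \<gamma>\<close>, and the infinity-depth changes only because some of them change
  sign.  The whole theorem rests on one observation about two positive roots \<open>a\<close> and \<open>\<gamma>\<close> with
  \<open>B(a, \<gamma>) \<le> 0\<close>: a positive root \<open>\<eta>\<close> dominated by \<open>\<gamma>\<close> for which \<open>s\<^sub>a \<eta>\<close> is negative is itself
  still dominated by \<open>s\<^sub>a \<gamma>\<close> (lemma \<open>dominates_kept\<close>).  Sending \<open>\<eta>\<close> to \<open>s\<^sub>a \<eta>\<close> when that is positive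
  and to \<open>\<eta>\<close> otherwise is therefore an injection which shows that the depth of \<open>s\<^sub>a \<gamma>\<close> is at least
  that of \<open>\<gamma>\<close>.  The injection misses \<open>a\<close>, and if \<open>B(a, \<gamma>) \<le> -1\<close> then \<open>a\<close> is dominated by
  \<open>s\<^sub>a \<gamma>\<close> and the depth increases strictly.

  For (2), write \<open>x\<close> as a reduced word in the canonical simple reflections.  Each letter \<open>s\<^sub>a\<close>
  raises the length of the reflection by at most two, so additivity forces an increase of exactly
  two at each step, and this excludes \<open>B(a, \<gamma>) > 0\<close> by the exchange condition in \<open>W'\<close>
  (lemma \<open>rlen_reflection_drop\<close>).

  For (1), let \<open>x\<close> and \<open>y\<close> be the canonical simple roots.  If \<open>W'\<close> is infinite, then
  \<open>B(x, y) \<le> -1\<close>, and the positive roots of \<open>W'\<close> form two chains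
  \<open>x, s\<^sub>x y, s\<^sub>x s\<^sub>y x, \<dots>\<close> and \<open>y, s\<^sub>y x, s\<^sub>y s\<^sub>x y, \<dots>\<close>, whose \<open>n\<close>-th members, counted
  from \<open>n = 0\<close>, have reflections of length \<open>2n + 1\<close>.  Each member of a chain strictly dominates the previous one.  Each member of one
  chain is also carried to the next level of the other chain by a simple reflection with
  product at most \<open>-1\<close>, which increases the depth strictly.  Both facts come from one obstruction:
  an element making two roots with product at most \<open>-1\<close> negative would make an infinite chain
  negative, while inversion sets are finite.

  Everything uses that each root is positive or negative, which is derived from the
  representation by induction on the length of a group element (lemma \<open>chain_nonneg\<close>), and that the
  canonical simple reflections generate \<open>W'\<close> (lemma \<open>canonical_basis_generates_pos\<close>).
\<close>

section \<open>Words and word length in a group\<close>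

context group
begin

lemma word_val_Nil [simp]: "word_val G [] = \<one>"
  and word_val_Cons [simp]: "word_val G (x # ws) = x \<otimes> word_val G ws"
  by (simp_all add: word_val_def)

lemma word_val_closed:
  "ws \<in> lists X \<Longrightarrow> X \<subseteq> carrier G \<Longrightarrow> word_val G ws \<in> carrier G"
  by (induction ws) auto

lemma word_val_append:
  "us \<in> lists X \<Longrightarrow> vs \<in> lists X \<Longrightarrow> X \<subseteq> carrier G \<Longrightarrow>
    word_val G (us @ vs) = word_val G us \<otimes> word_val G vs"
proof (induction us)
  case (Cons u us)
  then show ?case
    using word_val_closed[of us X] word_val_closed[of vs X] by (auto simp: m_assoc)
qed (simp add: word_val_closed)

lemma rev_in_lists [simp]: "rev ws \<in> lists X \<longleftrightarrow> ws \<in> lists X"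
  by (simp add: in_lists_conv_set)

lemma word_val_rev:
  assumes "X \<subseteq> carrier G" "\<And>x. x \<in> X \<Longrightarrow> x \<otimes> x = \<one>"
  shows "ws \<in> lists X \<Longrightarrow> word_val G (rev ws) = inv (word_val G ws)"
proof (induction ws)
  case (Cons x ws)
  have x: "x \<in> carrier G" "inv x = x"
    using Cons assms by (auto intro: inv_equality)
  have "word_val G (rev ws @ [x]) = word_val G (rev ws) \<otimes> word_val G [x]"
    using Cons assms by (intro word_val_append[of _ X]) auto
  then show ?case
    using Cons x assms word_val_closed[of ws X] by (simp add: inv_mult_group)
qed simp

lemma generate_word:
  assumes "X \<subseteq> carrier G" "\<And>x. x \<in> X \<Longrightarrow> x \<otimes> x = \<one>"
  shows "w \<in> generate G X \<Longrightarrow> \<exists>ws \<in> lists X. word_val G ws = w"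
proof (induction rule: generate.induct)
  case one
  then show ?case by (intro bexI[of _ "[]"]) auto
next
  case (incl h)
  then show ?case using assms by (intro bexI[of _ "[h]"]) auto
next
  case (inv h)
  then have "inv h = h" using assms by (auto intro: inv_equality)
  then show ?case using inv assms by (intro bexI[of _ "[h]"]) auto
next
  case (eng h1 h2)
  then obtain us vs where "us \<in> lists X" "vs \<in> lists X"
      "word_val G us = h1" "word_val G vs = h2"
    by auto
  then show ?case using assms
    by (intro bexI[of _ "us @ vs"]) (auto simp: word_val_append[of _ X])
qed

lemma word_length_le:
  "ws \<in> lists X \<Longrightarrow> word_length G X (word_val G ws) \<le> length ws"
  unfolding word_length_def by (rule Least_le) auto

lemma reduced_word:
  assumes "X \<subseteq> carrier G" "\<And>x. x \<in> X \<Longrightarrow> x \<otimes> x = \<one>" "w \<in> generate G X"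
  obtains ws where "ws \<in> lists X" "word_val G ws = w" "length ws = word_length G X w"
proof -
  obtain us where us: "us \<in> lists X" "word_val G us = w"
    using generate_word[OF assms] by auto
  have "\<exists>ws \<in> lists X. length ws = word_length G X w \<and> word_val G ws = w"
    unfolding word_length_def by (rule LeastI_ex) (use us in auto)
  then show thesis using that by auto
qed

lemma word_length_mult:
  assumes X: "X \<subseteq> carrier G" "\<And>x. x \<in> X \<Longrightarrow> x \<otimes> x = \<one>"
    and vw: "v \<in> generate G X" "w \<in> generate G X"
  shows "word_length G X (v \<otimes> w) \<le> word_length G X v + word_length G X w"
proof -
  obtain us where us: "us \<in> lists X" "word_val G us = v" "length us = word_length G X v"
    by (rule reduced_word[OF X vw(1)])
  obtain vs where vs: "vs \<in> lists X" "word_val G vs = w" "length vs = word_length G X w"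
    by (rule reduced_word[OF X vw(2)])
  show ?thesis
    using word_length_le[of "us @ vs" X] us vs X by (simp add: word_val_append[of _ X])
qed

lemma word_length_gen:
  assumes "x \<in> X" "x \<in> carrier G"
  shows "word_length G X x \<le> 1"
  using word_length_le[of "[x]" X] assms by simp

lemma word_length_inv:
  assumes X: "X \<subseteq> carrier G" "\<And>x. x \<in> X \<Longrightarrow> x \<otimes> x = \<one>"
    and w: "w \<in> generate G X"
  shows "word_length G X (inv w) = word_length G X w"
proof -
  have le: "word_length G X (inv v) \<le> word_length G X v" if v: "v \<in> generate G X" for v
  proof -
    obtain vs where vs: "vs \<in> lists X" "word_val G vs = v" "length vs = word_length G X v"
      by (rule reduced_word[OF X v])
    show ?thesis
      using word_length_le[of "rev vs" X] vs word_val_rev[OF X, of vs]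
      by (metis length_rev rev_in_lists)
  qed
  have "w \<in> carrier G" using w X generate_incl by blast
  moreover have "inv w \<in> generate G X" using w X generate_m_inv_closed by blast
  ultimately show ?thesis using le[OF w] le[of "inv w"] by simp
qed

end

fun alternating :: "'a \<Rightarrow> 'a \<Rightarrow> nat \<Rightarrow> 'a list" where
  "alternating x y 0 = []"
| "alternating x y (Suc n) = x # alternating y x n"

lemma length_alternating [simp]: "length (alternating x y n) = n"
  by (induction x y n rule: alternating.induct) auto

lemma alternating_in_lists: "x \<in> X \<Longrightarrow> y \<in> X \<Longrightarrow> alternating x y n \<in> lists X"
  by (induction x y n rule: alternating.induct) auto

lemma alternating_prefix:
  "\<exists>zs. alternating x y (m + n) = alternating x y m @ zs \<and> length zs = n"
proof (induction m arbitrary: x y)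
  case (Suc m)
  then show ?case by (metis add_Suc alternating.simps(2) append_Cons)
qed simp

lemma alternating_snoc_odd:
  "alternating x y (2 * n + 2) = alternating x y (2 * n + 1) @ [y]"
  by (induction n) auto

text \<open>All relators have even length, so a Coxeter group has a sign character sending each generator
  to \<open>-1\<close>.  It is what forces the length to change under multiplication by a generator.\<close>

lemma coxeter_word_eq_parity:
  "coxeter_word_eq G S us vs \<Longrightarrow> even (length us) = even (length vs)"
proof (induction rule: coxeter_word_eq.induct)
  case (relator us vs s t)
  have "even (length (concat (replicate n [s, t])))" for n
    by (induction n) auto
  then show ?case by simp
qed auto

subsection \<open>Length in a Coxeter system\<close>

context coxeter_system
begin

lemma generator_involution: "s \<in> S \<Longrightarrow> s \<otimes> s = \<one>"
  using pow_ord_eq_1[of s] S_order_two[of s] S_subset by (auto simp: numeral_2_eq_2)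

abbreviation len :: "'a \<Rightarrow> nat" where
  "len \<equiv> word_length G S"

lemma word_parity:
  assumes us: "us \<in> lists S" and vs: "vs \<in> lists S" and eq: "word_val G us = word_val G vs"
  shows "even (length us) = even (length vs)"
proof -
  have "word_val G (us @ rev vs) = \<one>"
    using us vs eq S_subset word_val_rev[OF S_subset generator_involution, of vs]
      word_val_closed[of vs S]
    by (subst word_val_append[of _ S]) auto
  then have "coxeter_word_eq G S (us @ rev vs) []"
    using presentation us vs by (metis append_in_lists_conv rev_in_lists)
  from coxeter_word_eq_parity[OF this] show ?thesis by simp
qed

lemma len_reduced_word:
  assumes "w \<in> carrier G"
  obtains ws where "ws \<in> lists S" "word_val G ws = w" "length ws = len w"
  using reduced_word[OF S_subset generator_involution, of w] assms S_generates by auto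

lemma len_mult_generator:
  assumes w: "w \<in> carrier G" and s: "s \<in> S"
  shows "len (w \<otimes> s) = Suc (len w) \<or> Suc (len (w \<otimes> s)) = len w"
proof -
  have sc: "s \<in> carrier G" using s S_subset by auto
  note le = word_length_mult[OF S_subset generator_involution, unfolded S_generates]
  have le1: "len (w \<otimes> s) \<le> Suc (len w)"
    using le[OF _ w sc] word_length_gen[OF s sc] by linarith
  have "w = (w \<otimes> s) \<otimes> s"
    using w sc by (simp add: m_assoc generator_involution s)
  then have le2: "len w \<le> Suc (len (w \<otimes> s))"
    using le[of "w \<otimes> s" s] w sc word_length_gen[OF s sc] by force
  obtain ws where ws: "ws \<in> lists S" "word_val G ws = w" "length ws = len w"
    by (rule len_reduced_word[OF w])
  obtain vs where vs: "vs \<in> lists S" "word_val G vs = w \<otimes> s" "length vs = len (w \<otimes> s)"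
    by (rule len_reduced_word[of "w \<otimes> s"]) (use w sc in auto)
  have "word_val G vs = word_val G (ws @ [s])"
    using ws vs s sc S_subset by (simp add: word_val_append[of _ S])
  then have "even (length vs) \<noteq> even (length ws)"
    using word_parity[of vs "ws @ [s]"] ws vs s by auto
  then have "len (w \<otimes> s) \<noteq> len w" using ws vs by auto
  with le1 le2 show ?thesis by linarith
qed

lemma descent_exists:
  assumes w: "w \<in> carrier G" "w \<noteq> \<one>"
  obtains t where "t \<in> S" "Suc (len (w \<otimes> t)) = len w"
proof -
  obtain ws where ws: "ws \<in> lists S" "word_val G ws = w" "length ws = len w"
    by (rule len_reduced_word[OF w(1)])
  with w obtain vs t where vt: "ws = vs @ [t]" by (cases ws rule: rev_cases) auto
  have t: "t \<in> S" "t \<in> carrier G" and vs: "vs \<in> lists S" using ws vt S_subset by auto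
  have c: "word_val G vs \<in> carrier G" using word_val_closed[OF vs S_subset] .
  have "w = word_val G vs \<otimes> t"
    using ws vt t vs S_subset word_val_append[of vs S "[t]"] by auto
  then have "w \<otimes> t = word_val G vs"
    using c t by (simp add: m_assoc generator_involution)
  then have "len (w \<otimes> t) \<le> length vs" using word_length_le[OF vs] by simp
  then have "Suc (len (w \<otimes> t)) = len w"
    using len_mult_generator[OF w(1) t(1)] ws(3) vt by auto
  with that t show thesis by blast
qed

end

section \<open>Rank-two chains of roots\<close>

text \<open>The value at \<open>q/2\<close> of the Chebyshev polynomial of the second kind of degree \<open>n - 1\<close>; with
  \<open>q = -2 B(x, y)\<close> these are the coordinates of the roots of a dihedral group with simple roots \<open>x\<close>
  and \<open>y\<close>.\<close>

fun cheb :: "real \<Rightarrow> nat \<Rightarrow> real" where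
  "cheb q 0 = 0"
| "cheb q (Suc 0) = 1"
| "cheb q (Suc (Suc n)) = q * cheb q (Suc n) - cheb q n"

lemma cheb_cos: "cheb (2 * cos \<theta>) n * sin \<theta> = sin (real n * \<theta>)"
proof (induction "2 * cos \<theta>" n rule: cheb.induct)
  case (3 n)
  have eq: "sin (real (Suc (Suc n)) * \<theta>) = 2 * cos \<theta> * sin (real (Suc n) * \<theta>) - sin (real n * \<theta>)"
  proof -
    have "sin (x + \<theta>) + sin (x - \<theta>) = 2 * cos \<theta> * sin x" for x :: real
      by (simp add: sin_add sin_diff)
    from this[of "real (Suc n) * \<theta>"]
    have "sin (real (Suc n) * \<theta> + \<theta>) + sin (real (Suc n) * \<theta> - \<theta>)
        = 2 * cos \<theta> * sin (real (Suc n) * \<theta>)" .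
    moreover have "real (Suc n) * \<theta> + \<theta> = real (Suc (Suc n)) * \<theta>"
        "real (Suc n) * \<theta> - \<theta> = real n * \<theta>"
      by (simp_all add: algebra_simps)
    ultimately show ?thesis by simp
  qed
  have "cheb (2 * cos \<theta>) (Suc (Suc n)) * sin \<theta>
      = 2 * cos \<theta> * (cheb (2 * cos \<theta>) (Suc n) * sin \<theta>) - cheb (2 * cos \<theta>) n * sin \<theta>"
    by (simp add: algebra_simps)
  then show ?case using 3 eq by simp
qed simp_all

lemma cheb_increasing: "q \<ge> 2 \<Longrightarrow> cheb q n \<ge> 0 \<and> cheb q (Suc n) \<ge> cheb q n + 1"
proof (induction n)
  case (Suc n)
  then have "2 * cheb q (Suc n) \<le> q * cheb q (Suc n)"
    by (intro mult_right_mono) auto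
  moreover have "cheb q (Suc (Suc n)) = q * cheb q (Suc n) - cheb q n" by simp
  ultimately show ?case using Suc.IH[OF Suc.prems] by linarith
qed simp

lemma cheb_strict_mono: "q \<ge> 2 \<Longrightarrow> m < n \<Longrightarrow> cheb q m < cheb q n"
  by (erule lift_Suc_mono_less[where f = "cheb q", rotated]) (metis cheb_increasing less_add_one order_less_le_trans)

lemma cheb_shift:
  "cheb q (Suc (n + j)) = cheb q (Suc j) * cheb q (Suc n) - cheb q j * cheb q n"
proof (induction q j rule: cheb.induct)
  case (3 q j)
  have "cheb q (Suc (n + Suc (Suc j))) = q * cheb q (Suc (n + Suc j)) - cheb q (Suc (n + j))"
    by simp
  also have "\<dots> = cheb q (Suc (Suc (Suc j))) * cheb q (Suc n) - cheb q (Suc (Suc j)) * cheb q n"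
    unfolding 3 by (simp add: algebra_simps)
  finally show ?case .
qed simp_all

lemma cheb_antiperiodic:
  assumes "cheb q (Suc n) = 0" "cheb q n = 1"
  shows "cheb q (Suc n + j) = - cheb q j"
  using cheb_shift[of q n j] assms by simp

text \<open>For \<open>q < 2\<close> the sequence turns non-positive: the ratio of consecutive terms satisfies
  \<open>r' = q - 1/r \<le> r - (2 - q)\<close> as long as it is positive, because \<open>r + 1/r \<ge> 2\<close>.\<close>

lemma cheb_nonpos_exists:
  assumes q: "q < 2"
  shows "\<exists>n. cheb q (Suc n) \<le> 0"
proof (rule ccontr)
  assume "\<not> ?thesis"
  then have pos: "cheb q (Suc n) > 0" for n by (simp add: not_le)
  define r where "r n = cheb q (Suc (Suc n)) / cheb q (Suc n)" for n
  have rpos: "r n > 0" for n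
    using pos[of n] pos[of "Suc n"] by (simp add: r_def del: cheb.simps)
  have step: "r (Suc n) \<le> r n - (2 - q)" for n
  proof -
    have "r (Suc n) = q - 1 / r n"
      using pos[of n] pos[of "Suc n"] by (simp add: r_def divide_simps)
    moreover have "r n + 1 / r n \<ge> 2"
    proof -
      have "(r n - 1)\<^sup>2 \<ge> 0" by simp
      then show ?thesis using rpos[of n] by (simp add: field_simps power2_eq_square)
    qed
    ultimately show ?thesis by linarith
  qed
  have "r n \<le> r 0 - real n * (2 - q)" for n
  proof (induction n)
    case (Suc n)
    then show ?case using step[of n] by (simp add: algebra_simps)
  qed simp
  moreover obtain n where "r 0 < real n * (2 - q)"
    using reals_Archimedean3[of "2 - q"] q by auto
  ultimately show False using rpos[of n] by (smt (verit))
qed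

text \<open>For \<open>B(x, x) = B(y, y) = 1\<close> this is \<open>s\<^sub>x s\<^sub>y s\<^sub>x \<dots>\<close> with \<open>n\<close> alternating factors, applied to the
  one of \<open>x\<close> and \<open>y\<close> that would come next.\<close>

definition chain :: "('v \<Rightarrow> 'v \<Rightarrow> real) \<Rightarrow> 'v \<Rightarrow> 'v \<Rightarrow> nat \<Rightarrow> 'v::real_vector" where
  "chain B x y n = cheb (- 2 * B x y) (Suc n) *\<^sub>R x + cheb (- 2 * B x y) n *\<^sub>R y"

lemma chain_0 [simp]: "chain B x y 0 = x"
  by (simp add: chain_def)

section \<open>Positive and negative roots\<close>

locale coxeter_geometry =
  coxeter_system G S + geometric_representation G \<phi> S B \<alpha>
  for G (structure) and S :: "'a set" and \<phi> :: "'a \<Rightarrow> 'v \<Rightarrow> 'v::real_vector"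
    and B :: "'v \<Rightarrow> 'v \<Rightarrow> real" and \<alpha> :: "'a \<Rightarrow> 'v"
begin

abbreviation refl :: "'v \<Rightarrow> 'v \<Rightarrow> 'v" where "refl \<equiv> reflection B"
abbreviation refl_elt :: "'v \<Rightarrow> 'a" where "refl_elt \<equiv> root_reflection G \<phi> B"
abbreviation \<Phi> :: "'v set" where "\<Phi> \<equiv> roots G \<phi> S \<alpha>"
abbreviation \<Phi>pos :: "'v set" where "\<Phi>pos \<equiv> pos_roots G \<phi> S \<alpha>"
abbreviation \<Phi>neg :: "'v set" where "\<Phi>neg \<equiv> neg_roots G \<phi> S \<alpha>"

lemma B_simps:
  "B (x + y) z = B x z + B y z" "B z (x + y) = B z x + B z y"
  "B (x - y) z = B x z - B y z" "B z (x - y) = B z x - B z y"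
  "B (r *\<^sub>R x) z = r * B x z" "B z (r *\<^sub>R x) = r * B z x"
  "B (- x) z = - B x z" "B z (- x) = - B z x"
  using B_bilinear
  by (simp_all add: bilinear_ladd bilinear_radd bilinear_lsub bilinear_rsub
      bilinear_lmul bilinear_rmul bilinear_lneg bilinear_rneg)

lemma B_zero [simp]: "B 0 z = 0" "B z 0 = 0"
  using B_simps(5)[of 0 0 z] B_simps(6)[of z 0 0] by auto

lemma B_sum_right: "B z (\<Sum>i\<in>I. f i) = (\<Sum>i\<in>I. B z (f i))"
  by (induction I rule: infinite_finite_induct) (auto simp: B_simps)

lemma S_carrier [simp]: "s \<in> S \<Longrightarrow> s \<in> carrier G"
  using S_subset by auto

lemma act_mult [simp]:
  "g \<in> carrier G \<Longrightarrow> h \<in> carrier G \<Longrightarrow> \<phi> (g \<otimes> h) v = \<phi> g (\<phi> h v)"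
  using composition_rule by blast

lemma act_one [simp]: "\<phi> \<one> v = v"
  by (metis UNIV_I id_eq_one restrict_apply')

lemma act_inv [simp]:
  "g \<in> carrier G \<Longrightarrow> \<phi> (inv g) (\<phi> g v) = v"
  "g \<in> carrier G \<Longrightarrow> \<phi> g (\<phi> (inv g) v) = v"
  by (metis act_mult act_one inv_closed l_inv) (metis act_mult act_one inv_closed r_inv)

lemma act_linear:
  assumes "g \<in> carrier G"
  shows "\<phi> g (x + y) = \<phi> g x + \<phi> g y" "\<phi> g (x - y) = \<phi> g x - \<phi> g y"
    "\<phi> g (r *\<^sub>R x) = r *\<^sub>R \<phi> g x" "\<phi> g (- x) = - \<phi> g x"
  using action_linear[OF assms]
  by (simp_all add: linear_add linear_diff linear_scale linear_neg)

lemma act_eqI: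
  "g \<in> carrier G \<Longrightarrow> h \<in> carrier G \<Longrightarrow> (\<And>v. \<phi> g v = \<phi> h v) \<Longrightarrow> g = h"
  using faithful by (metis ext inj_onD)

lemma act_reflection:
  assumes "g \<in> carrier G"
  shows "\<phi> g (refl x v) = refl (\<phi> g x) (\<phi> g v)"
  using assms by (simp add: reflection_def act_linear action_preserves_B)

lemma act_simple: "s \<in> S \<Longrightarrow> \<phi> s v = refl (\<alpha> s) v"
  using action_simple by simp

lemma reflection_add: "refl x (u + v) = refl x u + refl x v"
  and reflection_scale: "refl x (r *\<^sub>R v) = r *\<^sub>R refl x v"
  and reflection_minus: "refl x (- v) = - refl x v"
  and reflection_of_neg [simp]: "refl (- x) v = refl x v"
  by (simp_all add: reflection_def B_simps algebra_simps)

lemma reflection_self: "B x x = 1 \<Longrightarrow> refl x x = - x"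
  by (simp add: reflection_def scaleR_2)

lemma reflection_moves:
  assumes "x \<noteq> 0" "B x v \<noteq> 0"
  shows "refl x v \<noteq> v"
proof
  assume "refl x v = v"
  then have "(2 * B x v) *\<^sub>R x = 0" by (simp add: reflection_def)
  then show False using assms by simp
qed

lemma reflection_invol [simp]: "B x x = 1 \<Longrightarrow> refl x (refl x v) = v"
  by (simp add: reflection_def B_simps)

lemma reflection_chain:
  assumes x: "B x x = 1"
  shows "refl x (chain B y x n) = chain B x y (Suc n)"
proof -
  have xy: "refl x y = y + (- 2 * B x y) *\<^sub>R x" and sym: "B y x = B x y"
    using B_symmetric[of x y] by (simp_all add: reflection_def)
  show ?thesis
    using x
    by (simp add: chain_def reflection_add reflection_scale reflection_self xy sym algebra_simps)
qed

lemma reflection_chain_Suc: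
  "B x x = 1 \<Longrightarrow> refl x (chain B x y (Suc n)) = chain B y x n"
  by (metis reflection_chain reflection_invol)

subsection \<open>The cone of non-negative combinations of simple roots\<close>

definition pos_cone :: "'v set" where
  "pos_cone = {\<Sum>s\<in>S. a s *\<^sub>R \<alpha> s | a. \<forall>s\<in>S. a s \<ge> (0::real)}"

lemma pos_cone_add:
  assumes "u \<in> pos_cone" "v \<in> pos_cone"
  shows "u + v \<in> pos_cone"
proof -
  obtain a where a: "\<And>s. s \<in> S \<Longrightarrow> a s \<ge> 0" "u = (\<Sum>s\<in>S. a s *\<^sub>R \<alpha> s)"
    using assms(1) unfolding pos_cone_def by blast
  obtain b where b: "\<And>s. s \<in> S \<Longrightarrow> b s \<ge> 0" "v = (\<Sum>s\<in>S. b s *\<^sub>R \<alpha> s)"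
    using assms(2) unfolding pos_cone_def by blast
  have "u + v = (\<Sum>s\<in>S. (a s + b s) *\<^sub>R \<alpha> s)"
    by (simp add: a b sum.distrib scaleR_add_left)
  then show ?thesis
    unfolding pos_cone_def by (intro CollectI exI[of _ "\<lambda>s. a s + b s"]) (simp add: a b)
qed

lemma pos_cone_scale:
  assumes "v \<in> pos_cone" "r \<ge> 0"
  shows "r *\<^sub>R v \<in> pos_cone"
proof -
  obtain a where a: "\<And>s. s \<in> S \<Longrightarrow> a s \<ge> 0" "v = (\<Sum>s\<in>S. a s *\<^sub>R \<alpha> s)"
    using assms(1) unfolding pos_cone_def by blast
  have "r *\<^sub>R v = (\<Sum>s\<in>S. (r * a s) *\<^sub>R \<alpha> s)"
    by (simp add: a scaleR_sum_right)
  then show ?thesis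
    unfolding pos_cone_def by (intro CollectI exI[of _ "\<lambda>s. r * a s"]) (simp add: a assms)
qed

lemma pos_cone_comb:
  "u \<in> pos_cone \<Longrightarrow> v \<in> pos_cone \<Longrightarrow> p \<ge> 0 \<Longrightarrow> q \<ge> 0 \<Longrightarrow> p *\<^sub>R u + q *\<^sub>R v \<in> pos_cone"
  by (intro pos_cone_add pos_cone_scale)

lemma pos_cone_pointed:
  assumes "v \<in> pos_cone" "- v \<in> pos_cone"
  shows "v = 0"
proof -
  obtain a where a: "\<And>s. s \<in> S \<Longrightarrow> a s \<ge> 0" "v = (\<Sum>s\<in>S. a s *\<^sub>R \<alpha> s)"
    using assms(1) unfolding pos_cone_def by blast
  obtain b where b: "\<And>s. s \<in> S \<Longrightarrow> b s \<ge> 0" "- v = (\<Sum>s\<in>S. b s *\<^sub>R \<alpha> s)"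
    using assms(2) unfolding pos_cone_def by blast
  have "(\<Sum>s\<in>S. (a s + b s) *\<^sub>R \<alpha> s) = v + - v"
    unfolding a(2)[symmetric] b(2) by (simp add: a(2) sum.distrib scaleR_add_left)
  then have "a s + b s = 0" if "s \<in> S" for s
    using simple_positively_independent[of "\<lambda>s. a s + b s", OF _ _ that] a b by simp
  then have "a s = 0" if "s \<in> S" for s
    using a(1)[OF that] b(1)[OF that] that by (metis add_nonneg_eq_0_iff)
  then show ?thesis by (simp add: a(2))
qed

lemma pos_cone_add_eq_0:
  assumes "u \<in> pos_cone" "v \<in> pos_cone" "u + v = 0"
  shows "u = 0"
  using pos_cone_pointed[of u] assms by (metis add.inverse_unique)

lemma simple_in_pos_cone: "s \<in> S \<Longrightarrow> \<alpha> s \<in> pos_cone"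
proof -
  assume s: "s \<in> S"
  have "(\<Sum>t\<in>S. (if t = s then 1 else 0) *\<^sub>R \<alpha> t) = (\<Sum>t\<in>S. if t = s then \<alpha> t else 0)"
    by (intro sum.cong) auto
  also have "\<dots> = \<alpha> s" using s S_finite by simp
  finally show ?thesis
    unfolding pos_cone_def by (intro CollectI exI[of _ "\<lambda>t. if t = s then 1 else 0"]) auto
qed

lemma simple_product_nonpos:
  assumes "s \<in> S" "t \<in> S" "s \<noteq> t"
  shows "B (\<alpha> s) (\<alpha> t) \<le> 0"
proof -
  have "cos (pi / real k) \<ge> 0" if "k \<ge> 2" for k :: nat
  proof (rule cos_ge_zero)
    show "pi / real k \<le> pi / 2" using that by (intro divide_left_mono) auto
    have "0 \<le> pi / real k" by simp
    then show "- (pi / 2) \<le> pi / real k" using pi_ge_zero by linarith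
  qed
  then show ?thesis using simple_product[OF assms] by auto
qed

text \<open>Simple roots span extremal rays of the cone, although they need not be linearly
  independent: a simple root that is a non-negative combination of the others would have
  non-positive product with itself.\<close>

lemma simple_extremal:
  assumes s: "s \<in> S" and u: "u \<in> pos_cone" and v: "v \<in> pos_cone"
    and sum: "u + v = r *\<^sub>R \<alpha> s"
  obtains c where "c \<ge> 0" "u = c *\<^sub>R \<alpha> s"
proof -
  obtain a where a: "\<And>s. s \<in> S \<Longrightarrow> a s \<ge> 0" "u = (\<Sum>s\<in>S. a s *\<^sub>R \<alpha> s)"
    using u unfolding pos_cone_def by blast
  obtain b where b: "\<And>s. s \<in> S \<Longrightarrow> b s \<ge> 0" "v = (\<Sum>s\<in>S. b s *\<^sub>R \<alpha> s)"
    using v unfolding pos_cone_def by blast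
  define e where "e t = a t + b t" for t
  have e: "e t \<ge> 0" if "t \<in> S" for t using a b that by (simp add: e_def)
  have split: "(\<Sum>t\<in>S. f t) = f s + (\<Sum>t\<in>S-{s}. f t)" for f :: "'a \<Rightarrow> 'v"
    using s S_finite by (simp add: sum.remove)
  have "(\<Sum>t\<in>S. e t *\<^sub>R \<alpha> t) = r *\<^sub>R \<alpha> s"
    using sum by (simp add: a b e_def sum.distrib scaleR_add_left)
  then have eq: "(\<Sum>t\<in>S-{s}. e t *\<^sub>R \<alpha> t) = (r - e s) *\<^sub>R \<alpha> s"
    by (simp add: split algebra_simps)
  have "e t = 0" if t: "t \<in> S - {s}" for t
  proof (cases "r - e s \<le> 0")
    case True
    define d where "d = (\<lambda>t. if t = s then e s - r else e t)"
    have "(\<Sum>t\<in>S. d t *\<^sub>R \<alpha> t) = d s *\<^sub>R \<alpha> s + (\<Sum>t\<in>S-{s}. e t *\<^sub>R \<alpha> t)"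
      by (simp add: split d_def)
    also have "\<dots> = 0" by (simp add: eq d_def algebra_simps)
    finally have "(\<Sum>t\<in>S. d t *\<^sub>R \<alpha> t) = 0" .
    then have "d t = 0"
      using simple_positively_independent[of d t] True e t by (simp add: d_def)
    then show ?thesis using t by (simp add: d_def)
  next
    case False
    have "B (\<alpha> s) (\<Sum>t\<in>S-{s}. e t *\<^sub>R \<alpha> t) \<le> 0"
      unfolding B_sum_right
      by (intro sum_nonpos) (use e s in \<open>auto simp: B_simps intro!: mult_nonneg_nonpos simple_product_nonpos\<close>)
    then show ?thesis using False eq s by (simp add: B_simps simple_norm)
  qed
  then have "a t = 0" if "t \<in> S - {s}" for t
    using a(1)[of t] b(1)[of t] that e_def by (metis DiffD1 add_nonneg_eq_0_iff)
  then have "u = a s *\<^sub>R \<alpha> s" by (simp add: a(2) split)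
  with that a(1)[OF s] show thesis by blast
qed

subsection \<open>Roots\<close>

lemma simple_root: "s \<in> S \<Longrightarrow> \<alpha> s \<in> \<Phi>"
  unfolding roots_def by (rule CollectI, rule exI[of _ \<one>]) auto

lemma act_root: "w \<in> carrier G \<Longrightarrow> \<beta> \<in> \<Phi> \<Longrightarrow> \<phi> w \<beta> \<in> \<Phi>"
  unfolding roots_def by (smt (verit) act_mult m_closed mem_Collect_eq)

lemma root_norm: "\<beta> \<in> \<Phi> \<Longrightarrow> B \<beta> \<beta> = 1"
  unfolding roots_def using action_preserves_B simple_norm by auto

lemma root_nonzero: "\<beta> \<in> \<Phi> \<Longrightarrow> \<beta> \<noteq> 0"
  using root_norm by fastforce

lemma root_reflection_exists:
  assumes "\<beta> \<in> \<Phi>"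
  shows "\<exists>w \<in> carrier G. \<phi> w = refl \<beta>"
proof -
  obtain w s where ws: "\<beta> = \<phi> w (\<alpha> s)" "w \<in> carrier G" "s \<in> S"
    using assms unfolding roots_def by auto
  have "\<phi> (w \<otimes> s \<otimes> inv w) v = refl \<beta> v" for v
    using ws act_reflection[OF ws(2), of "\<alpha> s" "\<phi> (inv w) v"] by (simp add: act_simple)
  then show ?thesis using ws by (intro bexI[of _ "w \<otimes> s \<otimes> inv w"]) auto
qed

lemma refl_elt:
  assumes "\<beta> \<in> \<Phi>"
  shows refl_elt_closed [simp]: "refl_elt \<beta> \<in> carrier G"
    and act_refl_elt: "\<phi> (refl_elt \<beta>) = refl \<beta>"
proof -
  have "\<exists>!w. w \<in> carrier G \<and> \<phi> w = refl \<beta>"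
    using root_reflection_exists[OF assms] by (metis act_eqI)
  from theI'[OF this] show "refl_elt \<beta> \<in> carrier G" "\<phi> (refl_elt \<beta>) = refl \<beta>"
    unfolding root_reflection_def by auto
qed

lemma refl_elt_eqI:
  assumes "\<beta> \<in> \<Phi>" "w \<in> carrier G" "\<And>v. \<phi> w v = refl \<beta> v"
  shows "refl_elt \<beta> = w"
  using assms by (intro act_eqI) (auto simp: act_refl_elt)

lemma refl_elt_act:
  assumes "w \<in> carrier G" "\<beta> \<in> \<Phi>"
  shows "refl_elt (\<phi> w \<beta>) = w \<otimes> refl_elt \<beta> \<otimes> inv w"
  using assms act_reflection[OF assms(1), of \<beta>]
  by (intro refl_elt_eqI act_root) (auto simp: act_refl_elt)

lemma refl_elt_simple: "s \<in> S \<Longrightarrow> refl_elt (\<alpha> s) = s"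
  by (rule refl_elt_eqI) (auto simp: simple_root act_simple)

lemma refl_elt_involution: "\<beta> \<in> \<Phi> \<Longrightarrow> refl_elt \<beta> \<otimes> refl_elt \<beta> = \<one>"
  by (rule act_eqI) (auto simp: act_refl_elt root_norm)

lemma refl_elt_inv: "\<beta> \<in> \<Phi> \<Longrightarrow> inv (refl_elt \<beta>) = refl_elt \<beta>"
  by (simp add: inv_equality refl_elt_involution)

lemma reflection_root: "\<beta> \<in> \<Phi> \<Longrightarrow> \<gamma> \<in> \<Phi> \<Longrightarrow> refl \<beta> \<gamma> \<in> \<Phi>"
  by (metis act_refl_elt act_root refl_elt_closed)

lemma refl_elt_reflection:
  "\<beta> \<in> \<Phi> \<Longrightarrow> \<gamma> \<in> \<Phi> \<Longrightarrow> refl_elt (refl \<beta> \<gamma>) = refl_elt \<beta> \<otimes> refl_elt \<gamma> \<otimes> refl_elt \<beta>"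
  using refl_elt_act[of "refl_elt \<beta>" \<gamma>] by (simp add: act_refl_elt refl_elt_inv)

lemma neg_root: "\<beta> \<in> \<Phi> \<Longrightarrow> - \<beta> \<in> \<Phi>"
  using reflection_root[of \<beta> \<beta>] by (simp add: reflection_self root_norm)

lemma refl_elt_neg: "\<beta> \<in> \<Phi> \<Longrightarrow> refl_elt (- \<beta>) = refl_elt \<beta>"
  by (rule refl_elt_eqI) (auto simp: neg_root act_refl_elt)

lemma pos_root_iff: "\<beta> \<in> \<Phi>pos \<longleftrightarrow> \<beta> \<in> \<Phi> \<and> \<beta> \<in> pos_cone"
  unfolding pos_roots_def pos_cone_def by auto

lemma pos_root_root: "\<beta> \<in> \<Phi>pos \<Longrightarrow> \<beta> \<in> \<Phi>"
  and pos_root_cone: "\<beta> \<in> \<Phi>pos \<Longrightarrow> \<beta> \<in> pos_cone"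
  by (simp_all add: pos_root_iff)

lemma neg_root_iff: "\<beta> \<in> \<Phi>neg \<longleftrightarrow> - \<beta> \<in> \<Phi>pos"
  unfolding neg_roots_def by (metis image_iff minus_minus)

lemma pos_neg_disjoint: "\<beta> \<in> \<Phi>pos \<Longrightarrow> \<beta> \<notin> \<Phi>neg"
  by (metis neg_root_iff pos_cone_pointed pos_root_iff root_nonzero)

lemma simple_pos_root: "s \<in> S \<Longrightarrow> \<alpha> s \<in> \<Phi>pos"
  by (simp add: pos_root_iff simple_in_pos_cone simple_root)

subsection \<open>Every root is positive or negative\<close>

lemma refl_elt_chain:
  assumes "x \<in> S" "y \<in> S"
  shows "chain B (\<alpha> x) (\<alpha> y) n \<in> \<Phi> \<and>
    refl_elt (chain B (\<alpha> x) (\<alpha> y) n) = word_val G (alternating x y (2 * n + 1))"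
  using assms
proof (induction n arbitrary: x y)
  case 0
  then show ?case by (simp add: simple_root refl_elt_simple)
next
  case (Suc n)
  have w: "word_val G (alternating y x (2 * n + 1)) \<in> carrier G"
    using Suc.prems by (intro word_val_closed[OF _ S_subset] alternating_in_lists)
  have step: "chain B (\<alpha> x) (\<alpha> y) (Suc n) = refl (\<alpha> x) (chain B (\<alpha> y) (\<alpha> x) n)"
    using Suc.prems by (simp add: reflection_chain simple_norm)
  have "refl_elt (chain B (\<alpha> x) (\<alpha> y) (Suc n))
      = x \<otimes> word_val G (alternating y x (2 * n + 1)) \<otimes> x"
    unfolding step using Suc by (simp add: refl_elt_reflection refl_elt_simple simple_root)
  also have "\<dots> = x \<otimes> word_val G (alternating y x (2 * n + 1) @ [x])"
    using Suc.prems w alternating_in_lists[of y S x "2 * n + 1"]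
    by (subst word_val_append[OF _ _ S_subset]) (auto simp: m_assoc)
  also have "\<dots> = word_val G (alternating x y (2 * Suc n + 1))"
    unfolding alternating_snoc_odd[symmetric] by simp
  finally show ?case
    unfolding step using Suc reflection_root simple_root by auto
qed

text \<open>The braid relation, for a finite bond, read off from the action: the chain that starts at
  \<open>\<alpha> x\<close> arrives at \<open>\<alpha> y\<close>, which makes an alternating word of length \<open>2m\<close> trivial.\<close>

lemma alternating_word_shortens:
  assumes xy: "x \<in> S" "y \<in> S" and k: "B (\<alpha> x) (\<alpha> y) = - cos (pi / real m)" and m: "m \<ge> 2"
  shows "word_val G (alternating x y (Suc m)) = word_val G (alternating y x (m - 1))"
proof -
  have sin_pos: "sin (pi / real m) > 0"
    using m by (intro sin_gt_zero) (auto simp: field_simps)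
  have trivial: "word_val G (alternating u v (2 * m)) = \<one>"
    if uv: "u \<in> S" "v \<in> S" and k: "B (\<alpha> u) (\<alpha> v) = - cos (pi / real m)" for u v
  proof -
    have kk: "B (\<alpha> v) (\<alpha> u) = - cos (pi / real m)" using k B_symmetric by simp
    define q where "q = 2 * cos (pi / real m)"
    have "cheb q m * sin (pi / real m) = 0"
      unfolding q_def cheb_cos using m by simp
    then have 1: "cheb q m = 0" using sin_pos by simp
    have "real (m - 1) * (pi / real m) = pi - pi / real m"
      using m by (simp add: of_nat_diff field_simps)
    then have "cheb q (m - 1) * sin (pi / real m) = sin (pi / real m)"
      unfolding q_def cheb_cos by simp
    then have 2: "cheb q (m - 1) = 1" using sin_pos by simp
    have "chain B (\<alpha> v) (\<alpha> u) (m - 1) = \<alpha> u"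
      using 1 2 m by (simp add: chain_def kk q_def[symmetric])
    then have "word_val G (alternating v u (2 * (m - 1) + 1)) = u"
      using refl_elt_chain[OF uv(2,1), of "m - 1"] uv by (simp add: refl_elt_simple)
    moreover have "2 * m = Suc (2 * (m - 1) + 1)" using m by simp
    ultimately show ?thesis
      using uv by (simp only: alternating.simps word_val_Cons) (simp add: generator_involution)
  qed
  have inverse: "word_val G (alternating u v j) = word_val G (alternating v u (2 * m - j))"
    if "u \<in> S" "v \<in> S" "B (\<alpha> u) (\<alpha> v) = - cos (pi / real m)" "j \<le> 2 * m" for u v j
    using that
  proof (induction j arbitrary: u v)
    case 0
    then show ?case using trivial[of v u] B_symmetric by simp
  next
    case (Suc j)
    then have "word_val G (alternating v u j) = word_val G (alternating u v (2 * m - j))"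
      using B_symmetric by simp
    moreover have "2 * m - j = Suc (2 * m - Suc j)" using Suc.prems by simp
    ultimately have "word_val G (alternating v u j)
        = u \<otimes> word_val G (alternating v u (2 * m - Suc j))" by simp
    then show ?case
      using Suc.prems word_val_closed[OF alternating_in_lists S_subset, of v u "2 * m - Suc j"]
      by (simp add: m_assoc[symmetric] generator_involution)
  qed
  have "2 * m - Suc m = m - 1" by simp
  then show ?thesis using inverse[OF xy k, of "Suc m"] m by simp
qed

lemma word_closed: "x \<in> S \<Longrightarrow> y \<in> S \<Longrightarrow> word_val G (alternating x y n) \<in> carrier G"
  by (intro word_val_closed[OF alternating_in_lists S_subset])

lemma len_alternating_le:
  assumes v: "v \<in> carrier G" and xy: "x \<in> S" "y \<in> S"
  shows "len (v \<otimes> word_val G (alternating x y n)) \<le> len v + n"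
proof -
  have "len (word_val G (alternating x y n)) \<le> n"
    using word_length_le[OF alternating_in_lists[OF xy, of n]] by simp
  then show ?thesis
    using word_length_mult[OF S_subset generator_involution, unfolded S_generates,
        OF _ v word_closed[OF xy, of n]]
    by fastforce
qed

text \<open>If \<open>B(\<alpha>\<^sub>y, \<alpha>\<^sub>x) \<le> -1\<close>, the coefficients increase with \<open>n\<close>.  Otherwise they are
  \<open>sin(n\<pi>/m) / sin(\<pi>/m)\<close>, which is non-negative up to \<open>n = m\<close>, and an alternating word of more
  than \<open>m\<close> letters is shortened by the braid relation.\<close>

lemma cheb_nonneg_of_reduced:
  assumes xy: "x \<in> S" "y \<in> S" "x \<noteq> y" and v: "v \<in> carrier G"
    and l: "len (v \<otimes> word_val G (alternating y x (Suc n))) = len v + Suc n"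
  shows "cheb (- 2 * B (\<alpha> y) (\<alpha> x)) n \<ge> 0 \<and> cheb (- 2 * B (\<alpha> y) (\<alpha> x)) (Suc n) \<ge> 0"
  using simple_product[OF xy(2,1) xy(3)[symmetric]]
proof
  assume "B (\<alpha> y) (\<alpha> x) \<in> {..-1}"
  then have "2 \<le> - 2 * B (\<alpha> y) (\<alpha> x)" by simp
  from cheb_increasing[OF this, of n] show ?thesis by linarith
next
  assume "B (\<alpha> y) (\<alpha> x) \<in> {- cos (pi / real k) | k :: nat. k \<ge> 2}"
  then obtain m where m: "m \<ge> 2" and k: "B (\<alpha> y) (\<alpha> x) = - cos (pi / real m)" by auto
  have nm: "n < m"
  proof (rule ccontr)
    assume "\<not> n < m"
    then have "Suc n = Suc m + (n - m)" by simp
    then obtain zs where zs: "alternating y x (Suc n) = alternating y x (Suc m) @ zs"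
        "length zs = n - m"
      using alternating_prefix[of y x "Suc m" "n - m"] by metis
    have lists: "alternating y x (Suc m) \<in> lists S" "zs \<in> lists S"
      "alternating x y (m - 1) \<in> lists S"
      using alternating_in_lists[of y S x "Suc n"] alternating_in_lists[of x S y "m - 1"]
        alternating_in_lists[of y S x "Suc m"] zs xy
      by auto
    have "word_val G (alternating y x (Suc n)) = word_val G (alternating x y (m - 1) @ zs)"
      unfolding zs(1) using lists alternating_word_shortens[OF xy(2,1) k m]
      by (simp only: word_val_append[OF _ _ S_subset])
    then have "len (word_val G (alternating y x (Suc n))) \<le> n - 1"
      using word_length_le[of "alternating x y (m - 1) @ zs" S] lists zs(2) m \<open>\<not> n < m\<close> by auto
    moreover have "len (v \<otimes> word_val G (alternating y x (Suc n)))
        \<le> len v + len (word_val G (alternating y x (Suc n)))"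
      using word_length_mult[OF S_subset generator_involution, unfolded S_generates]
        v word_closed[OF xy(2,1)] by blast
    ultimately show False using l by linarith
  qed
  have sin_pos: "sin (pi / real m) > 0"
    using m by (intro sin_gt_zero) (auto simp: field_simps)
  have "cheb (2 * cos (pi / real m)) j \<ge> 0" if "j \<le> m" for j
  proof -
    have "sin (real j * (pi / real m)) \<ge> 0"
      using that m by (intro sin_ge_zero) (auto simp: field_simps)
    then show ?thesis
      using cheb_cos[of "pi / real m" j] sin_pos by (metis zero_le_mult_iff not_less)
  qed
  then show ?thesis using nm k by simp
qed

text \<open>Induction on \<open>\<ell>(v)\<close>: a descent of \<open>v\<close> in \<open>{x, y}\<close> is moved into the alternating word;
  once there is none, both \<open>v \<alpha>\<^sub>x\<close> and \<open>v \<alpha>\<^sub>y\<close> are known to be non-negative through another descent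
  of \<open>v\<close>, and it remains to see that the rank-two part is a non-negative combination.\<close>

lemma chain_nonneg:
  assumes "v \<in> carrier G" "x \<in> S" "y \<in> S" "x \<noteq> y"
    and "len (v \<otimes> word_val G (alternating y x (Suc n))) = len v + Suc n"
  shows "\<phi> v (chain B (\<alpha> y) (\<alpha> x) n) \<in> pos_cone"
  using assms
proof (induction "len v" arbitrary: v x y n rule: less_induct)
  case less
  note v = less.prems(1) and xy = less.prems(2-4) and l = less.prems(5)
  have y_up: "len (v \<otimes> y) = Suc (len v)"
  proof -
    have "v \<otimes> word_val G (alternating y x (Suc n))
        = (v \<otimes> y) \<otimes> word_val G (alternating x y n)"
      using v xy word_closed[of x y n] by (simp add: m_assoc)
    then have "len v + Suc n \<le> len (v \<otimes> y) + n"
      using l len_alternating_le[of "v \<otimes> y" x y n] v xy by simp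
    then show ?thesis using len_mult_generator[OF v xy(2)] by linarith
  qed
  show ?case
  proof (cases "len (v \<otimes> x) < len v")
    case True
    then have lx: "Suc (len (v \<otimes> x)) = len v"
      using len_mult_generator[OF v xy(1)] by linarith
    have "(v \<otimes> x) \<otimes> word_val G (alternating x y (Suc (Suc n)))
        = v \<otimes> word_val G (alternating y x (Suc n))"
      using v xy word_closed[of y x "Suc n"]
      by (simp only: alternating.simps(2)[of x] word_val_Cons)
         (simp add: m_assoc[symmetric] generator_involution m_assoc[of v x x])
    then have "len ((v \<otimes> x) \<otimes> word_val G (alternating x y (Suc (Suc n))))
        = len (v \<otimes> x) + Suc (Suc n)"
      using l lx by simp
    then have "\<phi> (v \<otimes> x) (chain B (\<alpha> x) (\<alpha> y) (Suc n)) \<in> pos_cone"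
      using less.hyps[OF True, of y x "Suc n"] v xy by simp
    moreover have "\<phi> x (chain B (\<alpha> x) (\<alpha> y) (Suc n)) = chain B (\<alpha> y) (\<alpha> x) n"
      using xy by (simp add: act_simple simple_norm reflection_chain_Suc)
    ultimately show ?thesis using v xy by simp
  next
    case False
    then have x_up: "len (v \<otimes> x) = Suc (len v)"
      using len_mult_generator[OF v xy(1)] by linarith
    have pos: "\<phi> v (\<alpha> z) \<in> pos_cone" if z: "z \<in> {x, y}" for z
    proof (cases "v = \<one>")
      case True
      then show ?thesis using z xy simple_in_pos_cone by auto
    next
      case False
      then obtain t where t: "t \<in> S" "Suc (len (v \<otimes> t)) = len v"
        using descent_exists[OF v] by blast
      have zS: "z \<in> S" and tz: "t \<noteq> z" and zup: "len (v \<otimes> z) = Suc (len v)"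
        using z xy t x_up y_up by auto
      have "(v \<otimes> t) \<otimes> word_val G (alternating t z (Suc 1)) = v \<otimes> z"
        using v t zS by (simp add: m_assoc[symmetric]) (simp add: m_assoc generator_involution)
      then have "len ((v \<otimes> t) \<otimes> word_val G (alternating t z (Suc 1))) = len (v \<otimes> t) + Suc 1"
        using t zup by simp
      then have "\<phi> (v \<otimes> t) (chain B (\<alpha> t) (\<alpha> z) 1) \<in> pos_cone"
        using less.hyps[of "v \<otimes> t" z t 1] t v zS tz by auto
      moreover have "\<phi> t (chain B (\<alpha> t) (\<alpha> z) 1) = \<alpha> z"
        using t reflection_chain_Suc[of "\<alpha> t" "\<alpha> z" 0] by (simp add: act_simple simple_norm)
      ultimately show ?thesis using v t by simp
    qed
    have "\<phi> v (chain B (\<alpha> y) (\<alpha> x) n) = cheb (- 2 * B (\<alpha> y) (\<alpha> x)) (Suc n) *\<^sub>R \<phi> v (\<alpha> y)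
        + cheb (- 2 * B (\<alpha> y) (\<alpha> x)) n *\<^sub>R \<phi> v (\<alpha> x)"
      using v by (simp add: chain_def act_linear)
    then show ?thesis
      using pos pos_cone_comb cheb_nonneg_of_reduced[OF xy v l] by auto
  qed
qed

lemma ascent_nonneg:
  assumes w: "w \<in> carrier G" and y: "y \<in> S" and up: "len (w \<otimes> y) = Suc (len w)"
  shows "\<phi> w (\<alpha> y) \<in> pos_cone"
proof (cases "w = \<one>")
  case True
  then show ?thesis using y simple_in_pos_cone by auto
next
  case False
  then obtain t where t: "t \<in> S" "Suc (len (w \<otimes> t)) = len w"
    using descent_exists[OF w] by blast
  have ty: "t \<noteq> y" using t up by auto
  have "(w \<otimes> t) \<otimes> word_val G (alternating t y (Suc 1)) = w \<otimes> y"
    using w t y by (simp add: m_assoc[symmetric]) (simp add: m_assoc generator_involution)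
  then have "\<phi> (w \<otimes> t) (chain B (\<alpha> t) (\<alpha> y) 1) \<in> pos_cone"
    using chain_nonneg[of "w \<otimes> t" y t 1] t w y ty up by auto
  moreover have "\<phi> t (chain B (\<alpha> t) (\<alpha> y) 1) = \<alpha> y"
    using t reflection_chain_Suc[of "\<alpha> t" "\<alpha> y" 0] by (simp add: act_simple simple_norm)
  ultimately show ?thesis using w t by simp
qed

lemma root_cases:
  assumes "\<beta> \<in> \<Phi>"
  shows "\<beta> \<in> \<Phi>pos \<or> \<beta> \<in> \<Phi>neg"
proof -
  obtain w s where ws: "\<beta> = \<phi> w (\<alpha> s)" "w \<in> carrier G" "s \<in> S"
    using assms unfolding roots_def by auto
  show ?thesis
  proof (cases "len (w \<otimes> s) = Suc (len w)")
    case True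
    then show ?thesis using ascent_nonneg ws assms by (auto simp: pos_root_iff)
  next
    case False
    have "(w \<otimes> s) \<otimes> s = w" using ws by (simp add: m_assoc generator_involution)
    then have "len ((w \<otimes> s) \<otimes> s) = Suc (len (w \<otimes> s))"
      using False len_mult_generator[OF ws(2,3)] by auto
    then have "\<phi> (w \<otimes> s) (\<alpha> s) \<in> pos_cone"
      using ascent_nonneg[of "w \<otimes> s" s] ws by auto
    moreover have "\<phi> (w \<otimes> s) (\<alpha> s) = - \<beta>"
      using ws by (simp add: act_simple reflection_self simple_norm act_linear)
    ultimately show ?thesis using assms by (simp add: neg_root_iff pos_root_iff neg_root)
  qed
qed

lemma not_neg_iff_pos: "\<beta> \<in> \<Phi> \<Longrightarrow> \<beta> \<notin> \<Phi>neg \<longleftrightarrow> \<beta> \<in> \<Phi>pos"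
  using root_cases pos_neg_disjoint by blast

lemma neg_root_root: "\<beta> \<in> \<Phi>neg \<Longrightarrow> \<beta> \<in> \<Phi>"
  by (metis minus_minus neg_root neg_root_iff pos_root_root)

text \<open>If \<open>s \<beta>\<close> is negative, then \<open>\<beta>\<close> and \<open>-s \<beta>\<close> are non-negative with sum a multiple of \<open>\<alpha>\<^sub>s\<close>, so
  extremality makes \<open>\<beta>\<close> a multiple of \<open>\<alpha>\<^sub>s\<close>.\<close>

lemma simple_reflection_pos:
  assumes s: "s \<in> S" and \<beta>: "\<beta> \<in> \<Phi>pos" "\<beta> \<noteq> \<alpha> s"
  shows "refl (\<alpha> s) \<beta> \<in> \<Phi>pos"
proof (rule ccontr)
  assume "refl (\<alpha> s) \<beta> \<notin> \<Phi>pos"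
  then have neg: "- refl (\<alpha> s) \<beta> \<in> pos_cone"
    using root_cases reflection_root simple_root[OF s] pos_root_root[OF \<beta>(1)]
    by (metis neg_root_iff pos_root_cone)
  have "\<beta> + - refl (\<alpha> s) \<beta> = (2 * B (\<alpha> s) \<beta>) *\<^sub>R \<alpha> s"
    by (simp add: reflection_def)
  from simple_extremal[OF s pos_root_cone[OF \<beta>(1)] neg this]
  obtain c where c: "c \<ge> 0" "\<beta> = c *\<^sub>R \<alpha> s" by blast
  then have "c * c = 1"
    using root_norm[OF pos_root_root[OF \<beta>(1)]] simple_norm[OF s] by (simp add: B_simps)
  then have "c = 1" using c(1) by (metis abs_of_nonneg abs_square_eq_1 power2_eq_square)
  then show False using c \<beta> by simp
qed

lemma finite_inversions:
  assumes "w \<in> carrier G"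
  shows "finite {\<beta> \<in> \<Phi>pos. \<phi> w \<beta> \<in> \<Phi>neg}"
proof -
  have "finite {\<beta> \<in> \<Phi>pos. \<phi> (word_val G ws) \<beta> \<in> \<Phi>neg}" if "ws \<in> lists S" for ws
    using that
  proof (induction ws rule: rev_induct)
    case Nil
    have "{\<beta> \<in> \<Phi>pos. \<phi> (word_val G []) \<beta> \<in> \<Phi>neg} = {}" using pos_neg_disjoint by auto
    then show ?case by (simp only: finite.emptyI)
  next
    case (snoc s ws)
    then have s: "s \<in> S" and ws: "ws \<in> lists S" by auto
    let ?I = "{\<beta> \<in> \<Phi>pos. \<phi> (word_val G ws) \<beta> \<in> \<Phi>neg}"
    have "{\<beta> \<in> \<Phi>pos. \<phi> (word_val G (ws @ [s])) \<beta> \<in> \<Phi>neg} \<subseteq> insert (\<alpha> s) (refl (\<alpha> s) ` ?I)"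
    proof
      fix \<beta> assume "\<beta> \<in> {\<beta> \<in> \<Phi>pos. \<phi> (word_val G (ws @ [s])) \<beta> \<in> \<Phi>neg}"
      then have \<beta>: "\<beta> \<in> \<Phi>pos" "\<phi> (word_val G ws) (refl (\<alpha> s) \<beta>) \<in> \<Phi>neg"
        using s ws word_val_closed[OF ws S_subset]
        by (auto simp: word_val_append[OF _ _ S_subset] act_simple)
      have "\<beta> = refl (\<alpha> s) (refl (\<alpha> s) \<beta>)" using s by (simp add: simple_norm)
      then show "\<beta> \<in> insert (\<alpha> s) (refl (\<alpha> s) ` ?I)"
        using \<beta> simple_reflection_pos[OF s \<beta>(1)] by blast
    qed
    then show ?case using snoc ws finite_subset by blast
  qed
  then show ?thesis using len_reduced_word[OF assms] by metis
qed

end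

context coxeter_geometry
begin

section \<open>Dominance and the infinity-depth\<close>

lemma pos_comb:
  "p *\<^sub>R u + q *\<^sub>R v \<in> \<Phi> \<Longrightarrow> u \<in> \<Phi>pos \<Longrightarrow> v \<in> \<Phi>pos \<Longrightarrow> p \<ge> 0 \<Longrightarrow> q \<ge> 0 \<Longrightarrow>
    p *\<^sub>R u + q *\<^sub>R v \<in> \<Phi>pos"
  by (simp add: pos_root_iff pos_cone_comb)

lemma neg_comb:
  assumes "p *\<^sub>R u + q *\<^sub>R v \<in> \<Phi>" "u \<in> \<Phi>neg" "v \<in> \<Phi>neg" "p \<ge> 0" "q \<ge> 0"
  shows "p *\<^sub>R u + q *\<^sub>R v \<in> \<Phi>neg"
proof -
  have "- (p *\<^sub>R u + q *\<^sub>R v) = p *\<^sub>R (- u) + q *\<^sub>R (- v)" by simp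
  then show ?thesis
    using assms pos_comb[of p "- u" q "- v"] by (metis neg_root neg_root_iff)
qed

lemma neg_reflection:
  assumes "a \<in> \<Phi>pos" "\<eta> \<in> \<Phi>pos" "refl a \<eta> \<in> \<Phi>neg"
  shows "B a \<eta> > 0"
proof (rule ccontr)
  assume "\<not> B a \<eta> > 0"
  moreover have "refl a \<eta> = 1 *\<^sub>R \<eta> + (- 2 * B a \<eta>) *\<^sub>R a" by (simp add: reflection_def)
  ultimately have "refl a \<eta> \<in> \<Phi>pos"
    using pos_comb[of 1 \<eta> "- 2 * B a \<eta>" a] assms neg_root_root by auto
  then show False using assms(3) pos_neg_disjoint by blast
qed

lemma inversion_iff:
  assumes "w \<in> carrier G"
  shows "\<beta> \<in> inversion_set G \<phi> S \<alpha> w \<longleftrightarrow> \<beta> \<in> \<Phi>pos \<and> \<phi> (inv w) \<beta> \<in> \<Phi>neg"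
proof -
  have "\<beta> \<in> \<phi> w ` \<Phi>neg \<longleftrightarrow> \<phi> (inv w) \<beta> \<in> \<Phi>neg"
    using assms by (metis act_inv image_iff)
  then show ?thesis by (simp add: inversion_set_def)
qed

text \<open>Stated with arbitrary roots \<open>\<eta>\<close> and \<open>\<beta>\<close> in place of positive ones, dominance is preserved
  by \<open>W\<close>.\<close>

definition dominates :: "'v \<Rightarrow> 'v \<Rightarrow> bool" where
  "dominates \<beta> \<eta> \<longleftrightarrow> (\<forall>w\<in>carrier G. \<phi> w \<beta> \<in> \<Phi>neg \<longrightarrow> \<phi> w \<eta> \<in> \<Phi>neg)"

lemma dominated_by_iff:
  assumes "\<beta> \<in> \<Phi>pos" "\<eta> \<in> \<Phi>pos"
  shows "dominated_by G \<phi> S \<alpha> \<eta> \<beta> \<longleftrightarrow> dominates \<beta> \<eta>"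
proof
  assume d: "dominated_by G \<phi> S \<alpha> \<eta> \<beta>"
  show "dominates \<beta> \<eta>"
    unfolding dominates_def
  proof (intro ballI impI)
    fix w assume "w \<in> carrier G" "\<phi> w \<beta> \<in> \<Phi>neg"
    then show "\<phi> w \<eta> \<in> \<Phi>neg"
      using d assms inversion_iff[of "inv w"] by (auto simp: dominated_by_def)
  qed
next
  assume "dominates \<beta> \<eta>"
  then show "dominated_by G \<phi> S \<alpha> \<eta> \<beta>"
    using assms by (auto simp: dominated_by_def dominates_def inversion_iff)
qed

lemma dominates_act:
  assumes g: "g \<in> carrier G" and d: "dominates \<beta> \<eta>"
  shows "dominates (\<phi> g \<beta>) (\<phi> g \<eta>)"
  unfolding dominates_def
proof (intro ballI impI)
  fix w assume "w \<in> carrier G" "\<phi> w (\<phi> g \<beta>) \<in> \<Phi>neg"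
  then show "\<phi> w (\<phi> g \<eta>) \<in> \<Phi>neg"
    using d g unfolding dominates_def by (metis act_mult m_closed)
qed

lemma dominates_reflection:
  "a \<in> \<Phi> \<Longrightarrow> dominates \<beta> \<eta> \<Longrightarrow> dominates (refl a \<beta>) (refl a \<eta>)"
  using dominates_act[of "refl_elt a" \<beta> \<eta>] by (simp add: act_refl_elt)

lemma dominates_trans: "dominates \<beta> \<eta> \<Longrightarrow> dominates \<eta> \<zeta> \<Longrightarrow> dominates \<beta> \<zeta>"
  by (simp add: dominates_def)

text \<open>Writing \<open>\<beta> = w \<alpha>\<^sub>s\<close>, the element \<open>s w\<^sup>-\<^sup>1\<close> makes \<open>\<beta>\<close> negative and \<open>w\<^sup>-\<^sup>1\<close> does not.  If \<open>\<eta>\<close>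
  behaves in the same way, then \<open>w\<^sup>-\<^sup>1 \<eta>\<close> is a positive root made negative by \<open>s\<close>.\<close>

lemma dominates_antisym:
  assumes "\<beta> \<in> \<Phi>" "\<eta> \<in> \<Phi>" "dominates \<beta> \<eta>" "dominates \<eta> \<beta>"
  shows "\<beta> = \<eta>"
proof -
  obtain w s where ws: "\<beta> = \<phi> w (\<alpha> s)" "w \<in> carrier G" "s \<in> S"
    using assms(1) unfolding roots_def by auto
  have iv: "\<phi> (inv w) \<beta> = \<alpha> s" using ws by simp
  have "\<phi> (inv w) \<eta> \<notin> \<Phi>neg"
    using assms(4) iv simple_pos_root[OF ws(3)] pos_neg_disjoint ws(2)
    unfolding dominates_def by (metis inv_closed)
  then have pos: "\<phi> (inv w) \<eta> \<in> \<Phi>pos"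
    using root_cases act_root assms(2) ws(2) by blast
  have "\<phi> (s \<otimes> inv w) \<beta> \<in> \<Phi>neg"
    using ws iv simple_pos_root[OF ws(3)]
    by (simp add: act_simple reflection_self simple_norm neg_root_iff)
  then have "\<phi> (s \<otimes> inv w) \<eta> \<in> \<Phi>neg"
    using assms(3) ws(2,3) unfolding dominates_def by (metis S_carrier inv_closed m_closed)
  then have "refl (\<alpha> s) (\<phi> (inv w) \<eta>) \<in> \<Phi>neg"
    using ws by (simp add: act_simple)
  then have "\<phi> (inv w) \<eta> = \<alpha> s"
    using simple_reflection_pos[OF ws(3) pos] pos_neg_disjoint by blast
  then show ?thesis using ws by (metis act_inv(2))
qed

abbreviation depth :: "'v \<Rightarrow> nat" where "depth \<equiv> inf_depth G \<phi> S \<alpha>"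

definition dominated :: "'v \<Rightarrow> 'v set" where
  "dominated \<beta> = {\<eta> \<in> \<Phi>pos. dominates \<beta> \<eta> \<and> \<eta> \<noteq> \<beta>}"

lemma depth_eq: "\<beta> \<in> \<Phi>pos \<Longrightarrow> depth \<beta> = card (dominated \<beta>)"
  unfolding inf_depth_def dominated_def
  by (rule arg_cong[where f = card]) (auto simp: dominated_by_iff)

lemma reflection_self_neg: "\<beta> \<in> \<Phi>pos \<Longrightarrow> refl \<beta> \<beta> \<in> \<Phi>neg"
  by (simp add: pos_root_root root_norm reflection_self neg_root_iff)

lemma finite_dominated:
  assumes "\<beta> \<in> \<Phi>pos"
  shows "finite (dominated \<beta>)"
proof -
  have "dominated \<beta> \<subseteq> {\<eta> \<in> \<Phi>pos. \<phi> (refl_elt \<beta>) \<eta> \<in> \<Phi>neg}"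
    using assms reflection_self_neg[OF assms] pos_root_root[OF assms]
    by (auto simp: dominated_def dominates_def act_refl_elt)
       (metis act_refl_elt refl_elt_closed)
  then show ?thesis
    using finite_inversions[of "refl_elt \<beta>"] pos_root_root[OF assms] finite_subset by auto
qed

text \<open>The map \<open>\<eta> \<mapsto> s\<^sub>a \<eta>\<close> sends the roots dominated by \<open>\<gamma>\<close> to those dominated by \<open>s\<^sub>a \<gamma>\<close>.  Where it
  produces a negative root, \<open>\<eta>\<close> itself can be kept instead: for \<open>w s\<^sub>a \<gamma> < 0\<close> either \<open>w a < 0\<close>, and
  \<open>w \<eta>\<close> is \<open>w s\<^sub>a \<eta> < 0\<close> plus a non-negative multiple of \<open>w a\<close>; or \<open>w a > 0\<close>, and then already
  \<open>w \<gamma> < 0\<close> because \<open>B(a, \<gamma>) \<le> 0\<close>.\<close>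

lemma dominates_kept:
  assumes a: "a \<in> \<Phi>pos" and \<gamma>: "\<gamma> \<in> \<Phi>pos" and le: "B a \<gamma> \<le> 0"
    and \<eta>: "\<eta> \<in> \<Phi>pos" "refl a \<eta> \<in> \<Phi>neg" and d: "dominates \<gamma> \<eta>"
  shows "dominates (refl a \<gamma>) \<eta>"
  unfolding dominates_def
proof (intro ballI impI)
  note roots = pos_root_root[OF a] pos_root_root[OF \<gamma>] pos_root_root[OF \<eta>(1)]
  fix w assume w: "w \<in> carrier G" and neg: "\<phi> w (refl a \<gamma>) \<in> \<Phi>neg"
  show "\<phi> w \<eta> \<in> \<Phi>neg"
  proof (cases "\<phi> w a \<in> \<Phi>neg")
    case True
    have "\<phi> (w \<otimes> refl_elt a) \<gamma> \<in> \<Phi>neg"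
      using neg w roots by (simp add: act_refl_elt)
    then have "\<phi> (w \<otimes> refl_elt a) \<eta> \<in> \<Phi>neg"
      using d w refl_elt_closed[OF roots(1)] unfolding dominates_def by (metis m_closed)
    then have "\<phi> w (refl a \<eta>) \<in> \<Phi>neg"
      using w roots by (simp add: act_refl_elt)
    moreover have eq: "\<phi> w \<eta> = 1 *\<^sub>R \<phi> w (refl a \<eta>) + (2 * B a \<eta>) *\<^sub>R \<phi> w a"
      using w by (simp add: reflection_def act_linear)
    ultimately show ?thesis
      using neg_comb[of 1 "\<phi> w (refl a \<eta>)" "2 * B a \<eta>" "\<phi> w a"] True
        neg_reflection[OF a \<eta>] act_root[OF w roots(3)]
      by simp
  next
    case False
    then have "- \<phi> w a \<in> \<Phi>neg"
      using root_cases[OF act_root[OF w roots(1)]] by (simp add: neg_root_iff)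
    moreover have eq: "\<phi> w \<gamma> = 1 *\<^sub>R \<phi> w (refl a \<gamma>) + (- 2 * B a \<gamma>) *\<^sub>R (- \<phi> w a)"
      using w by (simp add: reflection_def act_linear)
    ultimately have "\<phi> w \<gamma> \<in> \<Phi>neg"
      using neg_comb[of 1 "\<phi> w (refl a \<gamma>)" "- 2 * B a \<gamma>" "- \<phi> w a"] neg le
        act_root[OF w roots(2)]
      by simp
    then show ?thesis using d w unfolding dominates_def by blast
  qed
qed

lemma reflection_pos:
  assumes "a \<in> \<Phi>pos" "\<gamma> \<in> \<Phi>pos" "B a \<gamma> \<le> 0"
  shows "refl a \<gamma> \<in> \<Phi>pos"
  using neg_reflection[OF assms(1,2)] assms root_cases[OF reflection_root, of a \<gamma>]
  by (auto dest: pos_root_root)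

text \<open>The map \<open>f\<close> below, which replaces \<open>s\<^sub>a \<eta>\<close> by \<open>\<eta>\<close> where \<open>s\<^sub>a \<eta>\<close> is negative, injects the positive
  roots dominated by \<open>\<gamma>\<close> into those dominated by \<open>s\<^sub>a \<gamma>\<close>.  It misses \<open>a\<close>, which \<open>s\<^sub>a \<gamma>\<close> dominates
  exactly when \<open>\<gamma>\<close> dominates \<open>-a\<close>.\<close>

lemma
  assumes a: "a \<in> \<Phi>pos" and \<gamma>: "\<gamma> \<in> \<Phi>pos" and le: "B a \<gamma> \<le> 0"
  shows depth_reflection_mono: "depth \<gamma> \<le> depth (refl a \<gamma>)"
    and depth_reflection_strict: "dominates \<gamma> (- a) \<Longrightarrow> depth \<gamma> < depth (refl a \<gamma>)"
proof -
  note roots = pos_root_root[OF a] pos_root_root[OF \<gamma>]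
  note inv = reflection_invol[OF root_norm[OF roots(1)]]
  define f where "f \<eta> = (if refl a \<eta> \<in> \<Phi>pos then refl a \<eta> else \<eta>)" for \<eta>
  have refl_pos: "refl a \<gamma> \<in> \<Phi>pos" by (rule reflection_pos[OF a \<gamma> le])
  have neg: "refl a \<eta> \<in> \<Phi>neg" if "\<eta> \<in> \<Phi>pos" "refl a \<eta> \<notin> \<Phi>pos" for \<eta>
    using that root_cases[OF reflection_root[OF roots(1)]] pos_root_root by blast
  have img: "f ` dominated \<gamma> \<subseteq> dominated (refl a \<gamma>)"
  proof
    fix \<zeta> assume "\<zeta> \<in> f ` dominated \<gamma>"
    then obtain \<eta> where \<eta>: "\<eta> \<in> \<Phi>pos" "dominates \<gamma> \<eta>" "\<eta> \<noteq> \<gamma>" "\<zeta> = f \<eta>"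
      by (auto simp: dominated_def)
    show "\<zeta> \<in> dominated (refl a \<gamma>)"
    proof (cases "refl a \<eta> \<in> \<Phi>pos")
      case True
      moreover have "refl a \<eta> \<noteq> refl a \<gamma>" using \<eta>(3) inv by metis
      ultimately show ?thesis
        using \<eta> dominates_reflection[OF roots(1)] by (auto simp: f_def dominated_def)
    next
      case False
      have "\<eta> \<noteq> refl a \<gamma>" using False \<gamma> inv by metis
      then show ?thesis
        using \<eta> False dominates_kept[OF a \<gamma> le \<eta>(1) neg[OF \<eta>(1) False] \<eta>(2)]
        by (auto simp: f_def dominated_def)
    qed
  qed
  have inj: "inj_on f (dominated \<gamma>)"
  proof (rule inj_onI)
    fix x y assume "x \<in> dominated \<gamma>" "y \<in> dominated \<gamma>" "f x = f y"
    then show "x = y"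
      by (auto simp: f_def dominated_def split: if_splits) (metis inv)+
  qed
  have fin: "finite (dominated (refl a \<gamma>))" by (rule finite_dominated[OF refl_pos])
  show "depth \<gamma> \<le> depth (refl a \<gamma>)"
    using card_inj_on_le[OF inj img fin] \<gamma> refl_pos by (simp add: depth_eq)
  assume d: "dominates \<gamma> (- a)"
  have "dominates (refl a \<gamma>) a"
    using dominates_reflection[OF roots(1) d]
    by (simp add: reflection_minus reflection_self root_norm[OF roots(1)])
  moreover have "a \<noteq> refl a \<gamma>"
  proof
    assume "a = refl a \<gamma>"
    then have "refl a a = \<gamma>" by (metis inv)
    then have "\<gamma> = - a" by (simp add: reflection_self root_norm[OF roots(1)])
    then show False using \<gamma> a pos_neg_disjoint by (simp add: neg_root_iff)
  qed
  ultimately have "a \<in> dominated (refl a \<gamma>)" using a by (simp add: dominated_def)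
  moreover have "a \<notin> f ` dominated \<gamma>"
  proof
    assume "a \<in> f ` dominated \<gamma>"
    then obtain \<eta> where \<eta>: "\<eta> \<in> \<Phi>pos" "dominates \<gamma> \<eta>" "a = f \<eta>" by (auto simp: dominated_def)
    show False
    proof (cases "refl a \<eta> \<in> \<Phi>pos")
      case True
      then have "f \<eta> = refl a \<eta>" by (simp add: f_def)
      with \<eta>(3) have "a = refl a \<eta>" by metis
      then have "refl a a = \<eta>" by (metis inv)
      then have "\<eta> = - a" by (simp add: reflection_self root_norm[OF roots(1)])
      then show False using \<eta>(1) a pos_neg_disjoint by (simp add: neg_root_iff)
    next
      case False
      \<comment> \<open>A root \<open>\<gamma>\<close> dominating both \<open>a\<close> and \<open>-a\<close> could never become negative, but \<open>s\<^sub>\<gamma>\<close> makes it so.\<close>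
      then have "f \<eta> = \<eta>" by (simp add: f_def)
      then have "dominates \<gamma> a" using \<eta>(2,3) by metis
      moreover have "\<phi> (refl_elt \<gamma>) \<gamma> \<in> \<Phi>neg"
        using reflection_self_neg[OF \<gamma>] by (simp add: act_refl_elt roots)
      ultimately have "\<phi> (refl_elt \<gamma>) a \<in> \<Phi>neg" "\<phi> (refl_elt \<gamma>) (- a) \<in> \<Phi>neg"
        using d roots unfolding dominates_def by auto
      then show False
        using pos_neg_disjoint roots by (simp add: act_linear neg_root_iff)
    qed
  qed
  ultimately have "f ` dominated \<gamma> \<subset> dominated (refl a \<gamma>)" using img by blast
  then have "card (dominated \<gamma>) < card (dominated (refl a \<gamma>))"
    using psubset_card_mono[OF fin] card_image[OF inj] by metis
  then show "depth \<gamma> < depth (refl a \<gamma>)" using \<gamma> refl_pos by (simp add: depth_eq)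
qed

lemma depth_dominates_strict:
  assumes "\<beta> \<in> \<Phi>pos" "\<eta> \<in> \<Phi>pos" "dominates \<beta> \<eta>" "\<beta> \<noteq> \<eta>"
  shows "depth \<eta> < depth \<beta>"
proof -
  have "dominated \<eta> \<subset> dominated \<beta>"
  proof
    show "dominated \<eta> \<subseteq> dominated \<beta>"
    proof
      fix \<zeta> assume "\<zeta> \<in> dominated \<eta>"
      then have \<zeta>: "\<zeta> \<in> \<Phi>pos" "dominates \<eta> \<zeta>" "\<zeta> \<noteq> \<eta>" by (auto simp: dominated_def)
      have "\<zeta> \<noteq> \<beta>"
        using dominates_antisym[of \<eta> \<beta>] assms \<zeta>(2) pos_root_root by auto
      then show "\<zeta> \<in> dominated \<beta>"
        using \<zeta> dominates_trans[OF assms(3) \<zeta>(2)] by (simp add: dominated_def)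
    qed
    have "\<eta> \<in> dominated \<beta>" "\<eta> \<notin> dominated \<eta>" using assms by (auto simp: dominated_def)
    then show "dominated \<eta> \<noteq> dominated \<beta>" by blast
  qed
  from psubset_card_mono[OF finite_dominated[OF assms(1)] this]
  show ?thesis using assms by (simp add: depth_eq)
qed

section \<open>Canonical simple systems of reflection subgroups\<close>

text \<open>A reflection subgroup is handled through its roots alone, since conjugating it by a simple
  reflection then just means applying that reflection to a set of roots.\<close>

definition subsystem :: "'v set \<Rightarrow> bool" where
  "subsystem \<Psi> \<longleftrightarrow> \<Psi> \<subseteq> \<Phi> \<and> (\<forall>\<beta>\<in>\<Psi>. \<forall>\<gamma>\<in>\<Psi>. refl \<beta> \<gamma> \<in> \<Psi>)"

definition canonical_basis :: "'v set \<Rightarrow> 'v set" where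
  "canonical_basis \<Psi> = {\<beta> \<in> \<Psi> \<inter> \<Phi>pos. \<forall>\<eta> \<in> \<Psi> \<inter> \<Phi>pos. refl \<beta> \<eta> \<in> \<Phi>neg \<longrightarrow> \<eta> = \<beta>}"

lemma subsystem_neg: "subsystem \<Psi> \<Longrightarrow> \<beta> \<in> \<Psi> \<Longrightarrow> - \<beta> \<in> \<Psi>"
  unfolding subsystem_def by (metis reflection_self root_norm subsetD)

lemma simple_in_canonical_basis: "s \<in> S \<Longrightarrow> \<alpha> s \<in> \<Psi> \<Longrightarrow> \<alpha> s \<in> canonical_basis \<Psi>"
  using simple_pos_root simple_reflection_pos pos_neg_disjoint
  unfolding canonical_basis_def by blast

lemma subsystem_simple_image:
  assumes "subsystem \<Psi>" "s \<in> S"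
  shows "subsystem (refl (\<alpha> s) ` \<Psi>)"
  using assms reflection_root[OF simple_root[OF assms(2)]]
    act_reflection[OF S_carrier[OF assms(2)]]
  unfolding subsystem_def by (auto simp: act_simple) (metis imageI)

text \<open>Unless \<open>\<alpha>\<^sub>s\<close> lies in the subsystem, \<open>s\<close> preserves the sign of all its members.\<close>

lemma canonical_basis_simple_image:
  assumes \<Psi>: "subsystem \<Psi>" and s: "s \<in> S" "\<alpha> s \<notin> \<Psi>"
    and \<delta>: "\<delta> \<in> canonical_basis \<Psi>"
  shows "refl (\<alpha> s) \<delta> \<in> canonical_basis (refl (\<alpha> s) ` \<Psi>)"
proof -
  have invol: "refl (\<alpha> s) (refl (\<alpha> s) v) = v" for v using s by (simp add: simple_norm)
  have pos: "refl (\<alpha> s) \<eta> \<in> \<Phi>pos \<longleftrightarrow> \<eta> \<in> \<Phi>pos" if "\<eta> \<in> \<Psi>" for \<eta>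
  proof
    assume "\<eta> \<in> \<Phi>pos"
    then show "refl (\<alpha> s) \<eta> \<in> \<Phi>pos" using simple_reflection_pos s that by metis
  next
    assume p: "refl (\<alpha> s) \<eta> \<in> \<Phi>pos"
    show "\<eta> \<in> \<Phi>pos"
    proof (cases "refl (\<alpha> s) \<eta> = \<alpha> s")
      case True
      then have "refl (\<alpha> s) (\<alpha> s) = \<eta>" using invol[of \<eta>] by metis
      then have "\<eta> = - \<alpha> s" using s by (simp add: reflection_self simple_norm)
      then show ?thesis using subsystem_neg[OF \<Psi> that] s by simp
    next
      case False
      then show ?thesis using simple_reflection_pos[OF s(1) p] invol by simp
    qed
  qed
  have \<delta>': "\<delta> \<in> \<Psi>" "\<delta> \<in> \<Phi>pos" and only: "\<And>\<eta>. \<eta> \<in> \<Psi> \<Longrightarrow> \<eta> \<in> \<Phi>pos \<Longrightarrow> refl \<delta> \<eta> \<in> \<Phi>neg \<Longrightarrow> \<eta> = \<delta>"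
    using \<delta> unfolding canonical_basis_def by auto
  have "refl (\<alpha> s) \<eta> = refl (\<alpha> s) \<delta>"
    if \<eta>: "\<eta> \<in> \<Psi>" "refl (\<alpha> s) \<eta> \<in> \<Phi>pos" "refl (refl (\<alpha> s) \<delta>) (refl (\<alpha> s) \<eta>) \<in> \<Phi>neg" for \<eta>
  proof -
    have mem: "refl \<delta> \<eta> \<in> \<Psi>" using \<Psi> \<delta>' \<eta> unfolding subsystem_def by blast
    have "refl (\<alpha> s) (refl \<delta> \<eta>) \<in> \<Phi>neg"
      using \<eta>(3) act_reflection[of s \<delta> \<eta>] s by (simp add: act_simple)
    then have "refl \<delta> \<eta> \<in> \<Phi>neg"
      using pos[OF mem] mem \<Psi> root_cases pos_neg_disjoint unfolding subsystem_def by blast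
    then show ?thesis using only \<eta> pos by blast
  qed
  then show ?thesis
    using \<delta>' pos unfolding canonical_basis_def by auto
qed

lemma generate_conjugate:
  assumes s: "s \<in> carrier G" "s \<otimes> s = \<one>" and X: "X \<subseteq> carrier G" and Y: "Y \<subseteq> carrier G"
    and XY: "\<And>x. x \<in> X \<Longrightarrow> s \<otimes> x \<otimes> s \<in> Y"
  shows "w \<in> generate G X \<Longrightarrow> s \<otimes> w \<otimes> s \<in> generate G Y"
proof (induction rule: generate.induct)
  case one
  then show ?case using s generate.one by simp
next
  case (incl h)
  then show ?case using XY generate.incl by metis
next
  case (inv h)
  have h: "h \<in> carrier G" using inv X by blast
  have "inv s = s" using s inv_equality by blast
  then have "s \<otimes> inv h \<otimes> s = inv (s \<otimes> h \<otimes> s)"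
    using s h by (simp add: inv_mult_group m_assoc)
  then show ?case using XY[OF inv] generate.inv by metis
next
  case (eng h1 h2)
  have c: "h1 \<in> carrier G" "h2 \<in> carrier G"
    using eng(1,2) generate_in_carrier[OF X] by auto
  have "s \<otimes> (s \<otimes> (h2 \<otimes> s)) = h2 \<otimes> s"
    using s c by (simp add: m_assoc[symmetric])
  then have "s \<otimes> (h1 \<otimes> h2) \<otimes> s = (s \<otimes> h1 \<otimes> s) \<otimes> (s \<otimes> h2 \<otimes> s)"
    using s c by (simp add: m_assoc)
  then show ?case using generate.eng[OF eng.IH] by simp
qed

lemma gens_carrier: "\<Psi> \<subseteq> \<Phi> \<Longrightarrow> refl_elt ` canonical_basis \<Psi> \<subseteq> carrier G"
  unfolding canonical_basis_def by auto

text \<open>Dyer's theorem that the canonical simple reflections generate.  Take a word that makes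
  \<open>\<beta>\<close> negative and strip its last letter \<open>s\<close>, passing from \<open>\<beta>\<close> to \<open>s \<beta>\<close>.  If \<open>\<alpha>\<^sub>s\<close> belongs to the
  subsystem, it is in the canonical basis; otherwise the whole subsystem is moved by \<open>s\<close>
  along with \<open>\<beta>\<close>.\<close>

lemma canonical_basis_generates_pos:
  assumes "subsystem \<Psi>" "\<beta> \<in> \<Psi>" "\<beta> \<in> \<Phi>pos"
  shows "refl_elt \<beta> \<in> generate G (refl_elt ` canonical_basis \<Psi>)"
proof -
  have main: "refl_elt \<beta> \<in> generate G (refl_elt ` canonical_basis \<Psi>)"
    if "ws \<in> lists S" "subsystem \<Psi>" "\<beta> \<in> \<Psi>" "\<beta> \<in> \<Phi>pos" "\<phi> (word_val G ws) \<beta> \<in> \<Phi>neg" for ws \<Psi> \<beta>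
    using that
  proof (induction ws arbitrary: \<Psi> \<beta> rule: rev_induct)
    case Nil
    then show ?case using pos_neg_disjoint by auto
  next
    case (snoc s ws)
    note \<Psi> = snoc.prems(2) and \<beta> = snoc.prems(3,4)
    from snoc.prems have s: "s \<in> S" and ws: "ws \<in> lists S" by auto
    have neg: "\<phi> (word_val G ws) (refl (\<alpha> s) \<beta>) \<in> \<Phi>neg"
      using snoc.prems(5) s ws word_val_closed[OF ws S_subset]
      by (simp add: word_val_append[OF _ _ S_subset] act_simple)
    have invol: "refl (\<alpha> s) (refl (\<alpha> s) v) = v" for v using s by (simp add: simple_norm)
    have elt: "refl_elt (refl (\<alpha> s) \<beta>) = s \<otimes> refl_elt \<beta> \<otimes> s"
      using refl_elt_reflection[OF simple_root[OF s] pos_root_root[OF \<beta>(2)]]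
      by (simp add: refl_elt_simple s)
    have "s \<otimes> (s \<otimes> refl_elt \<beta> \<otimes> s) \<otimes> s = (s \<otimes> s) \<otimes> refl_elt \<beta> \<otimes> (s \<otimes> s)"
      using s pos_root_root[OF \<beta>(2)] by (simp add: m_assoc)
    then have conj_twice: "s \<otimes> (s \<otimes> refl_elt \<beta> \<otimes> s) \<otimes> s = refl_elt \<beta>"
      using s pos_root_root[OF \<beta>(2)] by (simp only: generator_involution) simp
    have \<Psi>\<Phi>: "\<Psi> \<subseteq> \<Phi>" using \<Psi> by (simp add: subsystem_def)
    consider "\<beta> = \<alpha> s" | "\<beta> \<noteq> \<alpha> s" "\<alpha> s \<in> \<Psi>" | "\<alpha> s \<notin> \<Psi>" by blast
    then show ?case
    proof cases
      case 1
      then show ?thesis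
        using simple_in_canonical_basis[OF s, of \<Psi>] \<beta>(1) by (auto intro: generate.incl)
    next
      case 2
      have basis: "s \<in> generate G (refl_elt ` canonical_basis \<Psi>)"
        using simple_in_canonical_basis[OF s 2(2)] refl_elt_simple[OF s]
        by (metis generate.incl imageI)
      have "refl (\<alpha> s) \<beta> \<in> \<Psi>" using \<Psi> 2 \<beta> unfolding subsystem_def by blast
      note IH = snoc.IH[OF ws \<Psi> this simple_reflection_pos[OF s \<beta>(2) 2(1)] neg, unfolded elt]
      have gen: "s \<otimes> (s \<otimes> refl_elt \<beta> \<otimes> s) \<otimes> s \<in> generate G (refl_elt ` canonical_basis \<Psi>)"
        by (rule generate.eng[OF generate.eng[OF basis IH] basis])
      show ?thesis using gen unfolding conj_twice .
    next
      case 3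
      define \<Psi>' where "\<Psi>' = refl (\<alpha> s) ` \<Psi>"
      have image_back: "refl (\<alpha> s) ` \<Psi>' = \<Psi>" by (simp add: \<Psi>'_def image_image invol)
      have \<Psi>': "subsystem \<Psi>'" unfolding \<Psi>'_def by (rule subsystem_simple_image[OF \<Psi> s])
      have notin: "\<alpha> s \<notin> \<Psi>'"
      proof
        assume "\<alpha> s \<in> \<Psi>'"
        then have "refl (\<alpha> s) (\<alpha> s) \<in> \<Psi>" using image_back by blast
        then show False
          using subsystem_neg[OF \<Psi>, of "- \<alpha> s"] 3 s by (simp add: reflection_self simple_norm)
      qed
      have "\<beta> \<noteq> \<alpha> s" using 3 \<beta> by blast
      then have pos: "refl (\<alpha> s) \<beta> \<in> \<Phi>pos" by (rule simple_reflection_pos[OF s \<beta>(2)])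
      have mem: "refl (\<alpha> s) \<beta> \<in> \<Psi>'" using \<beta> by (simp add: \<Psi>'_def)
      have gen': "s \<otimes> refl_elt \<beta> \<otimes> s \<in> generate G (refl_elt ` canonical_basis \<Psi>')"
        using snoc.IH[OF ws \<Psi>' mem pos neg] elt by simp
      have gen: "s \<otimes> (s \<otimes> refl_elt \<beta> \<otimes> s) \<otimes> s \<in> generate G (refl_elt ` canonical_basis \<Psi>)"
      proof (rule generate_conjugate[OF _ _ _ _ _ gen'])
        fix x assume "x \<in> refl_elt ` canonical_basis \<Psi>'"
        then obtain \<delta> where \<delta>: "\<delta> \<in> canonical_basis \<Psi>'" "x = refl_elt \<delta>" by blast
        have "\<delta> \<in> \<Phi>" using \<delta> pos_root_root unfolding canonical_basis_def by blast
        then have "s \<otimes> x \<otimes> s = refl_elt (refl (\<alpha> s) \<delta>)"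
          using refl_elt_reflection[OF simple_root[OF s]] by (simp add: refl_elt_simple s \<delta>)
        moreover have "refl (\<alpha> s) \<delta> \<in> canonical_basis \<Psi>"
          using canonical_basis_simple_image[OF \<Psi>' s notin \<delta>(1)] image_back by simp
        ultimately show "s \<otimes> x \<otimes> s \<in> refl_elt ` canonical_basis \<Psi>" by simp
      qed (use s generator_involution gens_carrier \<Psi>\<Phi> \<Psi>' in \<open>auto simp: subsystem_def\<close>)
      show ?thesis using gen unfolding conj_twice .
    qed
  qed
  have \<beta>: "\<beta> \<in> \<Phi>" using assms pos_root_root by blast
  obtain ws where ws: "ws \<in> lists S" "word_val G ws = refl_elt \<beta>"
    using len_reduced_word[OF refl_elt_closed[OF \<beta>]] by metis
  show ?thesis
    using main[OF ws(1) assms] reflection_self_neg[OF assms(3)] \<beta> by (simp add: ws act_refl_elt)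
qed

end

section \<open>Length and depth in a reflection subgroup\<close>

locale reflection_subsystem = coxeter_geometry G S \<phi> B \<alpha>
  for G (structure) and S :: "'a set" and \<phi> :: "'a \<Rightarrow> 'v \<Rightarrow> 'v::real_vector"
    and B :: "'v \<Rightarrow> 'v \<Rightarrow> real" and \<alpha> :: "'a \<Rightarrow> 'v" +
  fixes \<Psi> :: "'v set"
  assumes subsystem: "subsystem \<Psi>"
begin

abbreviation basis :: "'v set" where "basis \<equiv> canonical_basis \<Psi>"
abbreviation gens :: "'a set" where "gens \<equiv> refl_elt ` basis"
abbreviation rlen :: "'a \<Rightarrow> nat" where "rlen \<equiv> word_length G gens"

lemma sub_root: "\<beta> \<in> \<Psi> \<Longrightarrow> \<beta> \<in> \<Phi>"
  using subsystem unfolding subsystem_def by blast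

lemma sub_reflection: "\<beta> \<in> \<Psi> \<Longrightarrow> \<gamma> \<in> \<Psi> \<Longrightarrow> refl \<beta> \<gamma> \<in> \<Psi>"
  using subsystem unfolding subsystem_def by blast

lemma basis_mem: "d \<in> basis \<Longrightarrow> d \<in> \<Psi>" and basis_pos: "d \<in> basis \<Longrightarrow> d \<in> \<Phi>pos"
  and basis_root: "d \<in> basis \<Longrightarrow> d \<in> \<Phi>"
  using sub_root unfolding canonical_basis_def by auto

lemma basis_reflection_pos:
  assumes "d \<in> basis" "\<eta> \<in> \<Psi>" "\<eta> \<in> \<Phi>pos" "\<eta> \<noteq> d"
  shows "refl d \<eta> \<in> \<Phi>pos"
proof -
  have "refl d \<eta> \<notin> \<Phi>neg" using assms unfolding canonical_basis_def by blast
  then show ?thesis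
    using not_neg_iff_pos sub_root sub_reflection[OF basis_mem[OF assms(1)] assms(2)] by blast
qed

lemma gens_subset: "gens \<subseteq> carrier G"
  using basis_root by auto

lemma gens_involution: "x \<in> gens \<Longrightarrow> x \<otimes> x = \<one>"
  using basis_root refl_elt_involution by auto

lemma refl_elt_generated:
  assumes "\<beta> \<in> \<Psi>"
  shows "refl_elt \<beta> \<in> generate G gens"
proof (cases "\<beta> \<in> \<Phi>pos")
  case True
  then show ?thesis using canonical_basis_generates_pos[OF subsystem assms] by blast
next
  case False
  then have "- \<beta> \<in> \<Phi>pos"
    using root_cases[OF sub_root[OF assms]] by (simp add: neg_root_iff)
  then show ?thesis
    using canonical_basis_generates_pos[OF subsystem subsystem_neg[OF subsystem assms]]
      refl_elt_neg[OF sub_root[OF assms]] by simp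
qed

lemma generated_carrier: "w \<in> generate G gens \<Longrightarrow> w \<in> carrier G"
  using generate_in_carrier[OF gens_subset] .

lemma generated_mult: "v \<in> generate G gens \<Longrightarrow> w \<in> generate G gens \<Longrightarrow> v \<otimes> w \<in> generate G gens"
  by (rule generate.eng)

lemma generated_inv: "w \<in> generate G gens \<Longrightarrow> inv w \<in> generate G gens"
  by (rule generate_m_inv_closed[OF gens_subset])

lemma basis_generated: "a \<in> basis \<Longrightarrow> refl_elt a \<in> generate G gens"
  by (simp add: generate.incl)

lemma basis_words:
  assumes "ws \<in> lists gens"
  obtains ds where "ds \<in> lists basis" "ws = map refl_elt ds"
  using assms by (auto simp: lists_image)

lemma basis_word_closed: "ds \<in> lists basis \<Longrightarrow> word_val G (map refl_elt ds) \<in> carrier G"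
  using basis_root by (induction ds) auto

lemma basis_word_act: "ds \<in> lists basis \<Longrightarrow> \<eta> \<in> \<Psi> \<Longrightarrow> \<phi> (word_val G (map refl_elt ds)) \<eta> \<in> \<Psi>"
proof (induction ds)
  case (Cons d ds)
  then show ?case
    using basis_word_closed[of ds] basis_root[of d] basis_mem[of d]
    by (simp add: act_refl_elt sub_reflection)
qed simp

lemma generated_word:
  assumes "w \<in> generate G gens"
  obtains ds where "ds \<in> lists basis" "w = word_val G (map refl_elt ds)" "length ds = rlen w"
proof -
  obtain ws where ws: "ws \<in> lists gens" "word_val G ws = w" "length ws = rlen w"
    by (rule reduced_word[OF gens_subset gens_involution assms])
  obtain ds where "ds \<in> lists basis" "ws = map refl_elt ds"
    by (rule basis_words[OF ws(1)])
  with ws that show thesis by simp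
qed

lemma generated_act: "w \<in> generate G gens \<Longrightarrow> \<eta> \<in> \<Psi> \<Longrightarrow> \<phi> w \<eta> \<in> \<Psi>"
  using generated_word basis_word_act by metis

text \<open>The exchange condition: reading the word from the right, at some letter the image of \<open>a\<close>
  turns negative, so at that place it equals the root of the letter, and the letter cancels.\<close>

lemma exchange:
  assumes a: "a \<in> basis"
  shows "ds \<in> lists basis \<Longrightarrow> \<phi> (word_val G (map refl_elt ds)) a \<in> \<Phi>neg \<Longrightarrow>
    \<exists>es \<in> lists basis. Suc (length es) = length ds \<and>
      word_val G (map refl_elt ds) \<otimes> refl_elt a = word_val G (map refl_elt es)"
proof (induction ds)
  case Nil
  then show ?case using basis_pos[OF a] pos_neg_disjoint by auto
next
  case (Cons d ds)
  let ?w = "word_val G (map refl_elt ds)"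
  have d: "d \<in> basis" "d \<in> \<Phi>" and ds: "ds \<in> lists basis" using Cons.prems basis_root by auto
  have w: "?w \<in> carrier G" by (rule basis_word_closed[OF ds])
  have ar: "a \<in> \<Phi>" by (rule basis_root[OF a])
  show ?case
  proof (cases "\<phi> ?w a \<in> \<Phi>neg")
    case True
    then obtain es where es: "es \<in> lists basis" "Suc (length es) = length ds"
        "?w \<otimes> refl_elt a = word_val G (map refl_elt es)"
      using Cons.IH[OF ds] by blast
    then have "word_val G (map refl_elt (d # ds)) \<otimes> refl_elt a = word_val G (map refl_elt (d # es))"
      using w d ar by (simp add: m_assoc)
    then show ?thesis using es d by (intro bexI[of _ "d # es"]) auto
  next
    case False
    then have "\<phi> ?w a \<in> \<Phi>pos" "\<phi> ?w a \<in> \<Psi>"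
      using basis_word_act[OF ds basis_mem[OF a]] not_neg_iff_pos sub_root by auto
    moreover have "refl d (\<phi> ?w a) \<in> \<Phi>neg"
      using Cons.prems w d by (simp add: act_refl_elt)
    ultimately have "\<phi> ?w a = d"
      using basis_reflection_pos[OF d(1)] pos_neg_disjoint by blast
    then have "refl_elt d = ?w \<otimes> refl_elt a \<otimes> inv ?w"
      using refl_elt_act[OF w ar] by simp
    then have "refl_elt d \<otimes> ?w \<otimes> refl_elt a = ?w"
      using w ar refl_elt_involution[OF ar] by (simp add: m_assoc)
    then show ?thesis using ds by (intro bexI[of _ ds]) auto
  qed
qed

lemma rlen_mult: "v \<in> generate G gens \<Longrightarrow> w \<in> generate G gens \<Longrightarrow> rlen (v \<otimes> w) \<le> rlen v + rlen w"
  by (rule word_length_mult[OF gens_subset gens_involution])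

lemma rlen_inv: "w \<in> generate G gens \<Longrightarrow> rlen (inv w) = rlen w"
  by (rule word_length_inv[OF gens_subset gens_involution])

lemma rlen_basis: "a \<in> basis \<Longrightarrow> rlen (refl_elt a) \<le> 1"
  using word_length_gen[of "refl_elt a" gens] basis_root by auto

lemma mult_basis_twice:
  "w \<in> carrier G \<Longrightarrow> a \<in> basis \<Longrightarrow> w \<otimes> refl_elt a \<otimes> refl_elt a = w"
  using basis_root by (simp add: m_assoc refl_elt_involution)

lemma rlen_descent:
  assumes w: "w \<in> generate G gens" and a: "a \<in> basis" and neg: "\<phi> w a \<in> \<Phi>neg"
  shows "rlen (w \<otimes> refl_elt a) < rlen w"
proof -
  obtain ds where ds: "ds \<in> lists basis" "w = word_val G (map refl_elt ds)" "length ds = rlen w"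
    by (rule generated_word[OF w])
  then obtain es where es: "es \<in> lists basis" "Suc (length es) = length ds"
      "w \<otimes> refl_elt a = word_val G (map refl_elt es)"
    using exchange[OF a ds(1)] neg by auto
  have "map refl_elt es \<in> lists gens" using es(1) by auto
  then show ?thesis using word_length_le[of "map refl_elt es" gens] es ds by simp
qed

lemma rlen_ascent:
  assumes w: "w \<in> generate G gens" and a: "a \<in> basis" and pos: "\<phi> w a \<in> \<Phi>pos"
  shows "rlen w < rlen (w \<otimes> refl_elt a)"
proof -
  have "\<phi> (w \<otimes> refl_elt a) a \<in> \<Phi>neg"
    using pos generated_carrier[OF w] basis_root[OF a]
    by (simp add: act_refl_elt reflection_self root_norm act_linear neg_root_iff)
  from rlen_descent[OF generated_mult[OF w basis_generated[OF a]] a this]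
  show ?thesis using mult_basis_twice[OF generated_carrier[OF w] a] by simp
qed

lemma rlen_ascent_left:
  assumes w: "w \<in> generate G gens" and a: "a \<in> basis" and pos: "\<phi> (inv w) a \<in> \<Phi>pos"
  shows "rlen w < rlen (refl_elt a \<otimes> w)"
proof -
  have "inv (refl_elt a \<otimes> w) = inv w \<otimes> refl_elt a"
    using generated_carrier[OF w] basis_root[OF a] by (simp add: inv_mult_group refl_elt_inv)
  then have "rlen (refl_elt a \<otimes> w) = rlen (inv w \<otimes> refl_elt a)"
    using rlen_inv[OF generated_mult[OF basis_generated[OF a] w]] by simp
  then show ?thesis
    using rlen_ascent[OF generated_inv[OF w] a pos] rlen_inv[OF w] by simp
qed

lemma rlen_reflection_le:
  assumes a: "a \<in> basis" and \<gamma>: "\<gamma> \<in> \<Psi>"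
  shows "rlen (refl_elt (refl a \<gamma>)) \<le> rlen (refl_elt \<gamma>) + 2"
proof -
  have eq: "refl_elt (refl a \<gamma>) = refl_elt a \<otimes> refl_elt \<gamma> \<otimes> refl_elt a"
    by (rule refl_elt_reflection[OF basis_root[OF a] sub_root[OF \<gamma>]])
  have "rlen (refl_elt a \<otimes> refl_elt \<gamma> \<otimes> refl_elt a)
      \<le> rlen (refl_elt a) + rlen (refl_elt \<gamma>) + rlen (refl_elt a)"
    using rlen_mult generated_mult basis_generated[OF a] refl_elt_generated[OF \<gamma>]
    by (meson add_le_mono1 le_trans)
  then show ?thesis unfolding eq using rlen_basis[OF a] by linarith
qed

text \<open>If \<open>B(a, \<gamma>) > 0\<close>, then \<open>s\<^sub>\<gamma> a\<close> must be negative: otherwise \<open>a\<close> is a positive combination of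
  \<open>\<gamma>\<close> and \<open>s\<^sub>\<gamma> a\<close>, both of which stay positive under \<open>s\<^sub>a\<close> while \<open>a\<close> does not.  So \<open>s\<^sub>a\<close> is a
  descent of \<open>s\<^sub>\<gamma>\<close>.\<close>

lemma rlen_reflection_drop:
  assumes a: "a \<in> basis" and \<gamma>: "\<gamma> \<in> \<Psi>" "\<gamma> \<in> \<Phi>pos" "\<gamma> \<noteq> a" and B: "B a \<gamma> > 0"
  shows "rlen (refl_elt (refl a \<gamma>)) \<le> rlen (refl_elt \<gamma>)"
proof -
  note roots = basis_root[OF a] sub_root[OF \<gamma>(1)]
  note norm = root_norm[OF roots(1)] root_norm[OF roots(2)]
  have mem: "refl \<gamma> a \<in> \<Psi>" by (rule sub_reflection[OF \<gamma>(1) basis_mem[OF a]])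
  have "refl \<gamma> a \<in> \<Phi>neg"
  proof (rule ccontr)
    assume "refl \<gamma> a \<notin> \<Phi>neg"
    then have pos: "refl \<gamma> a \<in> \<Phi>pos" using not_neg_iff_pos[OF sub_root[OF mem]] by blast
    have "refl \<gamma> a \<noteq> a"
      using B B_symmetric[of \<gamma> a] by (intro reflection_moves root_nonzero[OF roots(2)]) simp
    then have p1: "refl a (refl \<gamma> a) \<in> \<Phi>pos" using basis_reflection_pos[OF a mem pos] by blast
    have p2: "refl a \<gamma> \<in> \<Phi>pos" by (rule basis_reflection_pos[OF a \<gamma>])
    have "a = (2 * B \<gamma> a) *\<^sub>R \<gamma> + 1 *\<^sub>R refl \<gamma> a" by (simp add: reflection_def)
    then have "refl a a = (2 * B \<gamma> a) *\<^sub>R refl a \<gamma> + 1 *\<^sub>R refl a (refl \<gamma> a)"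
      by (metis reflection_add reflection_scale)
    moreover have "2 * B \<gamma> a \<ge> 0" using B B_symmetric[of \<gamma> a] by simp
    ultimately have "refl a a \<in> \<Phi>pos"
      using pos_comb[OF _ p2 p1] reflection_root[OF roots(1) roots(1)] by (metis zero_le_one)
    then show False using reflection_self_neg[OF basis_pos[OF a]] pos_neg_disjoint by blast
  qed
  then have "rlen (refl_elt \<gamma> \<otimes> refl_elt a) < rlen (refl_elt \<gamma>)"
    using rlen_descent[OF refl_elt_generated[OF \<gamma>(1)] a] by (simp add: act_refl_elt roots)
  moreover have eq: "refl_elt (refl a \<gamma>) = refl_elt a \<otimes> (refl_elt \<gamma> \<otimes> refl_elt a)"
    using refl_elt_reflection[OF roots] roots by (simp add: m_assoc)
  moreover have "rlen (refl_elt a \<otimes> (refl_elt \<gamma> \<otimes> refl_elt a))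
      \<le> rlen (refl_elt a) + rlen (refl_elt \<gamma> \<otimes> refl_elt a)"
    by (intro rlen_mult generated_mult basis_generated[OF a] refl_elt_generated[OF \<gamma>(1)])
  ultimately show ?thesis unfolding eq using rlen_basis[OF a] by linarith
qed

text \<open>If \<open>B(a, \<gamma>) < 0\<close>, then multiplying \<open>s\<^sub>\<gamma>\<close> by \<open>s\<^sub>a\<close> on the right and then on the left are both
  ascents, because \<open>s\<^sub>\<gamma> a\<close> and \<open>s\<^sub>a s\<^sub>\<gamma> a\<close> are both positive.\<close>

lemma rlen_reflection_rise:
  assumes a: "a \<in> basis" and \<gamma>: "\<gamma> \<in> \<Psi>" "\<gamma> \<in> \<Phi>pos" and B: "B a \<gamma> < 0"
  shows "rlen (refl_elt (refl a \<gamma>)) = rlen (refl_elt \<gamma>) + 2"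
proof -
  note roots = basis_root[OF a] sub_root[OF \<gamma>(1)]
  have B': "B \<gamma> a < 0" using B B_symmetric by simp
  have mem: "refl \<gamma> a \<in> \<Psi>" by (rule sub_reflection[OF \<gamma>(1) basis_mem[OF a]])
  have pos: "refl \<gamma> a \<in> \<Phi>pos"
    using reflection_pos[OF \<gamma>(2) basis_pos[OF a]] B' by simp
  have ne: "refl \<gamma> a \<noteq> a"
    using B' by (intro reflection_moves root_nonzero[OF roots(2)]) simp
  have gen: "refl_elt \<gamma> \<otimes> refl_elt a \<in> generate G gens"
    by (intro generated_mult basis_generated[OF a] refl_elt_generated[OF \<gamma>(1)])
  have "rlen (refl_elt \<gamma>) < rlen (refl_elt \<gamma> \<otimes> refl_elt a)"
    using rlen_ascent[OF refl_elt_generated[OF \<gamma>(1)] a] pos by (simp add: act_refl_elt roots)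
  moreover have "inv (refl_elt \<gamma> \<otimes> refl_elt a) = refl_elt a \<otimes> refl_elt \<gamma>"
    using roots by (simp add: inv_mult_group refl_elt_inv)
  then have "\<phi> (inv (refl_elt \<gamma> \<otimes> refl_elt a)) a \<in> \<Phi>pos"
    using basis_reflection_pos[OF a mem pos ne] roots by (simp add: act_refl_elt)
  then have "rlen (refl_elt \<gamma> \<otimes> refl_elt a) < rlen (refl_elt a \<otimes> (refl_elt \<gamma> \<otimes> refl_elt a))"
    by (rule rlen_ascent_left[OF gen a])
  moreover have eq: "refl_elt (refl a \<gamma>) = refl_elt a \<otimes> (refl_elt \<gamma> \<otimes> refl_elt a)"
    using refl_elt_reflection[OF roots] roots by (simp add: m_assoc)
  ultimately show ?thesis using rlen_reflection_le[OF a \<gamma>(1)] unfolding eq by linarith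
qed

text \<open>Each letter of the word can raise the length of the reflection by at most two, so under
  the additivity hypothesis each of them does, which excludes \<open>B(a, \<gamma>) > 0\<close> at every stage.\<close>

lemma depth_mono_of_additive:
  "ds \<in> lists basis \<Longrightarrow> \<gamma> \<in> \<Psi> \<Longrightarrow> \<gamma> \<in> \<Phi>pos \<Longrightarrow>
    rlen (refl_elt \<gamma>) + 2 * length ds
      \<le> rlen (refl_elt (\<phi> (word_val G (map refl_elt ds)) \<gamma>)) \<Longrightarrow>
    \<phi> (word_val G (map refl_elt ds)) \<gamma> \<in> \<Phi>pos \<and>
    depth \<gamma> \<le> depth (\<phi> (word_val G (map refl_elt ds)) \<gamma>) \<and>
    rlen (refl_elt (\<phi> (word_val G (map refl_elt ds)) \<gamma>)) = rlen (refl_elt \<gamma>) + 2 * length ds"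
proof (induction ds)
  case (Cons a ds)
  define \<eta> where "\<eta> = \<phi> (word_val G (map refl_elt ds)) \<gamma>"
  have a: "a \<in> basis" and ds: "ds \<in> lists basis" using Cons.prems(1) by auto
  have act: "\<phi> (word_val G (map refl_elt (a # ds))) \<gamma> = refl a \<eta>"
    using basis_word_closed[OF ds] basis_root[OF a] by (simp add: \<eta>_def act_refl_elt)
  have \<eta>: "\<eta> \<in> \<Psi>" unfolding \<eta>_def by (rule basis_word_act[OF ds Cons.prems(2)])
  have low: "rlen (refl_elt \<gamma>) + 2 * Suc (length ds) \<le> rlen (refl_elt (refl a \<eta>))"
    using Cons.prems(4) unfolding act by simp
  have "rlen (refl_elt \<gamma>) + 2 * length ds \<le> rlen (refl_elt \<eta>)"
    using order_trans[OF low rlen_reflection_le[OF a \<eta>]] by simp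
  then have IH: "\<eta> \<in> \<Phi>pos" "depth \<gamma> \<le> depth \<eta>"
      "rlen (refl_elt \<eta>) = rlen (refl_elt \<gamma>) + 2 * length ds"
    using Cons.IH[OF ds Cons.prems(2,3)] unfolding \<eta>_def by auto
  have up: "rlen (refl_elt (refl a \<eta>)) = rlen (refl_elt \<eta>) + 2"
    using low IH(3) rlen_reflection_le[OF a \<eta>] by (intro antisym) simp_all
  have "\<eta> \<noteq> a"
    using up by (auto simp: reflection_self root_norm basis_root[OF a] refl_elt_neg)
  then have "B a \<eta> \<le> 0"
    using rlen_reflection_drop[OF a \<eta> IH(1)] up by force
  then have "refl a \<eta> \<in> \<Phi>pos" "depth \<eta> \<le> depth (refl a \<eta>)"
    using reflection_pos depth_reflection_mono basis_pos[OF a] IH(1) by auto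
  then show ?case using IH up unfolding act by simp
qed simp

end

context coxeter_geometry
begin

section \<open>Infinite chains and dominance\<close>

lemma chain_root:
  "x \<in> \<Phi> \<Longrightarrow> y \<in> \<Phi> \<Longrightarrow> chain B x y n \<in> \<Phi>"
proof (induction n arbitrary: x y)
  case (Suc n)
  then show ?case
    using reflection_root[of x "chain B y x n"] reflection_chain[OF root_norm, of x y n] by simp
qed simp

lemma chain_pos:
  assumes "x \<in> \<Phi>pos" "y \<in> \<Phi>pos" "B x y \<le> -1"
  shows "chain B x y n \<in> \<Phi>pos"
proof -
  have "- 2 * B x y \<ge> 2" using assms by simp
  from cheb_increasing[OF this, of n] show ?thesis
    using pos_comb[OF _ assms(1,2)] chain_root[OF pos_root_root pos_root_root, OF assms(1,2), of n]
    unfolding chain_def by simp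
qed

text \<open>An element making \<open>x\<close> and \<open>y\<close> negative makes all their non-negative combinations negative that
  are roots, in particular the infinitely many members of the chain; but the inversion set of an
  element is finite.  The roots \<open>x\<close> and \<open>y\<close> may have either sign as long as the chain is positive.\<close>

lemma infinite_chain_obstruction:
  assumes x: "x \<in> \<Phi>" and y: "y \<in> \<Phi>" and B: "B x y \<le> -1"
    and pos: "\<And>n. chain B x y n \<in> \<Phi>pos"
    and w: "w \<in> carrier G"
  shows "\<not> (\<phi> w x \<in> \<Phi>neg \<and> \<phi> w y \<in> \<Phi>neg)"
proof
  assume neg: "\<phi> w x \<in> \<Phi>neg \<and> \<phi> w y \<in> \<Phi>neg"
  define q where "q = - 2 * B x y"
  have q: "q \<ge> 2" using B by (simp add: q_def)
  have "\<phi> w (chain B x y n) \<in> \<Phi>neg" for n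
  proof -
    have eq: "\<phi> w (chain B x y n) = cheb q (Suc n) *\<^sub>R \<phi> w x + cheb q n *\<^sub>R \<phi> w y"
      using w by (simp add: chain_def act_linear q_def)
    show ?thesis
      using neg_comb[of "cheb q (Suc n)" "\<phi> w x" "cheb q n" "\<phi> w y"] neg
        cheb_increasing[OF q, of n] act_root[OF w chain_root[OF x y, of n]]
      unfolding eq by simp
  qed
  then have "range (chain B x y) \<subseteq> {\<beta> \<in> \<Phi>pos. \<phi> w \<beta> \<in> \<Phi>neg}" using pos by auto
  then have fin: "finite (range (chain B x y))"
    using finite_inversions[OF w] finite_subset by blast
  have less: "chain B x y m \<noteq> chain B x y n" if mn: "m < n" for m n
  proof
    assume eq: "chain B x y m = chain B x y n"
    define p r where "p = cheb q (Suc n) - cheb q (Suc m)" and "r = cheb q n - cheb q m"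
    have pr: "p > 0" "r > 0" using cheb_strict_mono[OF q] mn by (auto simp: p_def r_def)
    have "p *\<^sub>R x + r *\<^sub>R y = 0"
      using eq unfolding chain_def q_def[symmetric] by (simp add: p_def r_def algebra_simps)
    then have "p *\<^sub>R \<phi> w x + r *\<^sub>R \<phi> w y = 0"
      using act_linear[OF w] by (metis diff_self)
    then have "p *\<^sub>R (- \<phi> w x) + r *\<^sub>R (- \<phi> w y) = 0"
      by (simp add: neg_eq_iff_add_eq_0 add.commute)
    then have "p *\<^sub>R (- \<phi> w x) = 0"
      using pos_cone_add_eq_0[OF pos_cone_scale pos_cone_scale, of "- \<phi> w x" p "- \<phi> w y" r]
        neg pr by (simp add: neg_root_iff pos_root_iff)
    then show False using pr root_nonzero[OF act_root[OF w x]] by simp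
  qed
  have "inj (chain B x y)" by (rule linorder_injI) (rule less)
  then show False using fin by (simp add: finite_image_iff)
qed

lemma reflection_isometry: "B x x = 1 \<Longrightarrow> B (refl x u) (refl x v) = B u v"
  using B_symmetric[of u x] by (simp add: reflection_def B_simps algebra_simps)

lemma chain_consecutive:
  assumes "x \<in> \<Phi>" "y \<in> \<Phi>"
  shows "B (chain B x y (Suc n)) (chain B x y n) = - B x y"
  using assms
proof (induction n arbitrary: x y)
  case 0
  then show ?case
    using root_norm[OF 0(1)] B_symmetric[of y x] by (simp add: chain_def B_simps)
next
  case (Suc n)
  note x = root_norm[OF Suc.prems(1)]
  show ?case
    unfolding reflection_chain[OF x, symmetric] reflection_isometry[OF x]
    using Suc B_symmetric[of y x] by simp
qed

text \<open>A tail of a chain is itself a chain, starting from a member and the negative of its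
  predecessor.\<close>

lemma chain_shift:
  assumes "B x y = k" "B (chain B x y (Suc n)) (- chain B x y n) = k"
  shows "chain B (chain B x y (Suc n)) (- chain B x y n) j = chain B x y (Suc n + j)"
proof -
  define q where "q = - 2 * k"
  have c: "chain B x y m = cheb q (Suc m) *\<^sub>R x + cheb q m *\<^sub>R y" for m
    by (simp add: chain_def assms(1) q_def)
  have 1: "cheb q (Suc (Suc n + j))
      = cheb q (Suc j) * cheb q (Suc (Suc n)) - cheb q j * cheb q (Suc n)"
    by (rule cheb_shift)
  have 2: "cheb q (Suc n + j) = cheb q (Suc j) * cheb q (Suc n) - cheb q j * cheb q n"
    using cheb_shift[of q n j] by simp
  have "chain B (chain B x y (Suc n)) (- chain B x y n) j
      = cheb q (Suc j) *\<^sub>R chain B x y (Suc n) - cheb q j *\<^sub>R chain B x y n"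
    unfolding chain_def[of B "chain B x y (Suc n)"] assms(2) q_def by simp
  also have "\<dots> = chain B x y (Suc n + j)"
    unfolding c 1 2 by (simp only: scaleR_add_right scaleR_scaleR scaleR_diff_left add_diff_add)
  finally show ?thesis .
qed

text \<open>An element making the later root negative and the earlier one positive would make negative
  both starting roots of the tail of the chain.\<close>

lemma chain_dominates:
  assumes x: "x \<in> \<Phi>pos" and y: "y \<in> \<Phi>pos" and B: "B x y \<le> -1"
  shows "dominates (chain B x y (Suc n)) (chain B x y n)"
  unfolding dominates_def
proof (intro ballI impI)
  fix w assume w: "w \<in> carrier G" and neg: "\<phi> w (chain B x y (Suc n)) \<in> \<Phi>neg"
  note roots = pos_root_root[OF x] pos_root_root[OF y]
  note c = chain_root[OF roots]
  have k: "B (chain B x y (Suc n)) (- chain B x y n) = B x y"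
    using chain_consecutive[OF roots, of n] by (simp add: B_simps)
  have "chain B (chain B x y (Suc n)) (- chain B x y n) j \<in> \<Phi>pos" for j
    unfolding chain_shift[OF HOL.refl k] by (rule chain_pos[OF x y B])
  then have "\<phi> w (- chain B x y n) \<notin> \<Phi>neg"
    using infinite_chain_obstruction[OF c neg_root[OF c] _ _ w, of "Suc n" n] B k neg by simp
  then show "\<phi> w (chain B x y n) \<in> \<Phi>neg"
    using w root_cases[OF act_root[OF w c[of n]]] by (auto simp: act_linear neg_root_iff)
qed

lemma dominates_neg:
  assumes "a \<in> \<Phi>pos" "\<gamma> \<in> \<Phi>pos" "B a \<gamma> \<le> -1"
  shows "dominates \<gamma> (- a)"
  unfolding dominates_def
proof (intro ballI impI)
  fix w assume w: "w \<in> carrier G" and neg: "\<phi> w \<gamma> \<in> \<Phi>neg"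
  note roots = pos_root_root[OF assms(1)] pos_root_root[OF assms(2)]
  have "\<phi> w a \<notin> \<Phi>neg"
    using infinite_chain_obstruction[OF roots assms(3) chain_pos[OF assms] w] neg by blast
  then show "\<phi> w (- a) \<in> \<Phi>neg"
    using w root_cases[OF act_root[OF w roots(1)]] by (auto simp: act_linear neg_root_iff)
qed

end

section \<open>Dihedral reflection subgroups\<close>

context reflection_subsystem
begin

lemma basis_not_proportional:
  assumes x: "x \<in> basis" and y: "y \<in> basis" and xy: "x \<noteq> y" and eq: "p *\<^sub>R x = r *\<^sub>R y"
  shows "p = 0"
proof (rule ccontr)
  assume p: "p \<noteq> 0"
  have "B (p *\<^sub>R x) (p *\<^sub>R x) = B (r *\<^sub>R y) (r *\<^sub>R y)" by (simp add: eq)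
  then have "p * p = r * r"
    using root_norm basis_root x y by (simp add: B_simps)
  then consider "r = p" | "r = - p" by (auto simp: square_eq_iff)
  then show False
  proof cases
    case 1
    then show False using eq p xy by simp
  next
    case 2
    then have "p *\<^sub>R x = p *\<^sub>R (- y)" using eq by simp
    then have "x = - y" using p by (simp only: scaleR_cancel_left) simp
    then show False using basis_pos[OF x] basis_pos[OF y] pos_neg_disjoint[of x]
      by (simp add: neg_root_iff)
  qed
qed

text \<open>If \<open>B(x, y) > 0\<close>, then \<open>s\<^sub>y s\<^sub>x y = -y - 2 B(x, y) s\<^sub>y x\<close> is negative although \<open>s\<^sub>x y\<close> is a
  positive root different from \<open>y\<close>.\<close>

lemma basis_obtuse:
  assumes x: "x \<in> basis" and y: "y \<in> basis" and xy: "x \<noteq> y"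
  shows "B x y \<le> 0"
proof (rule ccontr)
  assume "\<not> B x y \<le> 0"
  then have k: "B x y > 0" by simp
  note norm = root_norm[OF basis_root[OF x]] root_norm[OF basis_root[OF y]]
  have p1: "refl x y \<in> \<Phi>pos"
    using basis_reflection_pos[OF x basis_mem[OF y] basis_pos[OF y]] xy by blast
  have p2: "refl y x \<in> \<Phi>pos"
    using basis_reflection_pos[OF y basis_mem[OF x] basis_pos[OF x]] xy by blast
  have mem: "refl x y \<in> \<Psi>" by (rule sub_reflection[OF basis_mem[OF x] basis_mem[OF y]])
  have ne: "refl x y \<noteq> y"
    using k by (intro reflection_moves root_nonzero[OF basis_root[OF x]]) simp
  have "refl x y = 1 *\<^sub>R y + (- 2 * B x y) *\<^sub>R x" by (simp add: reflection_def)
  then have "refl y (refl x y) = 1 *\<^sub>R refl y y + (- 2 * B x y) *\<^sub>R refl y x"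
    by (metis reflection_add reflection_scale)
  also have "\<dots> = 1 *\<^sub>R (- y) + (2 * B x y) *\<^sub>R (- refl y x)"
    by (simp add: reflection_self norm)
  finally have eq: "refl y (refl x y) = 1 *\<^sub>R (- y) + (2 * B x y) *\<^sub>R (- refl y x)" .
  have "refl y (refl x y) \<in> \<Phi>neg"
    using neg_comb[of 1 "- y" "2 * B x y" "- refl y x"] k p2 basis_pos[OF y]
      sub_root[OF sub_reflection[OF basis_mem[OF y] mem]]
    unfolding eq by (simp add: neg_root_iff)
  then show False
    using basis_reflection_pos[OF y mem p1 ne] pos_neg_disjoint by blast
qed

lemma chain_mem: "x \<in> \<Psi> \<Longrightarrow> y \<in> \<Psi> \<Longrightarrow> chain B x y n \<in> \<Psi>"
proof (induction n arbitrary: x y)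
  case (Suc n)
  then show ?case
    using sub_reflection[of x "chain B y x n"] reflection_chain[OF root_norm[OF sub_root], of x y n]
    by simp
qed simp

text \<open>In the dihedral case the two chains exhaust the root system up to sign: a positive root outside
  them would stay outside, hence positive, under the whole subgroup, which contains its own
  reflection.\<close>

lemma dihedral_root_in_chain:
  assumes basis: "basis = {x, y}" and \<gamma>: "\<gamma> \<in> \<Psi>"
  shows "\<exists>n. \<gamma> \<in> {chain B x y n, chain B y x n, - chain B x y n, - chain B y x n}"
proof (rule ccontr)
  define Z where "Z = {v. \<exists>n. v \<in> {chain B x y n, chain B y x n, - chain B x y n, - chain B y x n}}"
  have Z_neg: "- v \<in> Z \<longleftrightarrow> v \<in> Z" for v
    unfolding Z_def by (auto simp: minus_equation_iff) (metis minus_minus)+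
  have Z_refl: "refl d v \<in> Z" if d: "d \<in> basis" and v: "v \<in> Z" for d v
  proof -
    have dd: "B d d = 1" by (rule root_norm[OF basis_root[OF d]])
    have start: "refl d (chain B d e 0) \<in> Z" if "e \<in> {x, y}" "{d, e} = {x, y}" for e
    proof -
      have "refl d (chain B d e 0) = - chain B d e 0" by (simp add: reflection_self dd)
      then show ?thesis using that unfolding Z_def by (auto simp: doubleton_eq_iff intro: exI[of _ 0])
    qed
    have c: "refl d (chain B d e n) \<in> Z" "refl d (chain B e d n) \<in> Z"
      if e: "{d, e} = {x, y}" for e n
    proof -
      have "refl d (chain B e d n) = chain B d e (Suc n)" by (rule reflection_chain[OF dd])
      then show "refl d (chain B e d n) \<in> Z"
        using e unfolding Z_def by (auto simp: doubleton_eq_iff)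
      show "refl d (chain B d e n) \<in> Z"
      proof (cases n)
        case 0
        then show ?thesis using start e by auto
      next
        case (Suc m)
        then have "refl d (chain B d e n) = chain B e d m" using reflection_chain_Suc[OF dd] by simp
        then show ?thesis using e unfolding Z_def by (auto simp: doubleton_eq_iff)
      qed
    qed
    have "{d, y} = {x, y} \<or> {d, x} = {x, y}" using d basis by auto
    moreover obtain n where n: "v \<in> {chain B x y n, chain B y x n} \<or> - v \<in> {chain B x y n, chain B y x n}"
    proof -
      obtain n where "v \<in> {chain B x y n, chain B y x n, - chain B x y n, - chain B y x n}"
        using v unfolding Z_def by blast
      then show thesis by (intro that[of n]) auto
    qed
    ultimately have "refl d v \<in> Z \<or> refl d (- v) \<in> Z"
      using c by (auto simp: doubleton_eq_iff)
    then show ?thesis by (simp add: reflection_minus Z_neg)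
  qed
  assume "\<not> ?thesis"
  then have "\<gamma> \<notin> Z" by (simp add: Z_def)
  \<comment> \<open>\<open>Z\<close> is closed under negation, so the root may be taken positive.\<close>
  define \<beta> where "\<beta> = (if \<gamma> \<in> \<Phi>pos then \<gamma> else - \<gamma>)"
  have \<beta>: "\<beta> \<in> \<Psi>" "\<beta> \<in> \<Phi>pos" "\<beta> \<notin> Z"
    using \<open>\<gamma> \<notin> Z\<close> \<gamma> subsystem_neg[OF subsystem \<gamma>] root_cases[OF sub_root[OF \<gamma>]]
    by (auto simp: \<beta>_def Z_neg neg_root_iff)
  have stay: "\<phi> (word_val G (map refl_elt ds)) \<beta> \<in> \<Phi>pos - Z" if "ds \<in> lists basis" for ds
    using that
  proof (induction ds rule: list.induct)
    case Nil
    then show ?case using \<beta> by simp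
  next
    case (Cons d ds)
    define \<eta> where "\<eta> = \<phi> (word_val G (map refl_elt ds)) \<beta>"
    have d: "d \<in> basis" and ds: "ds \<in> lists basis" using Cons.prems by auto
    have \<eta>: "\<eta> \<in> \<Psi>" "\<eta> \<in> \<Phi>pos" "\<eta> \<notin> Z"
      using basis_word_act[OF ds \<beta>(1)] Cons.IH[OF ds] by (auto simp: \<eta>_def)
    have "chain B x y 0 \<in> Z" "chain B y x 0 \<in> Z" unfolding Z_def by blast+
    then have "d \<in> Z" using d basis by auto
    then have "\<eta> \<noteq> d" using \<eta> by blast
    then have pos: "refl d \<eta> \<in> \<Phi>pos" using basis_reflection_pos[OF d \<eta>(1,2)] by blast
    have "refl d \<eta> \<notin> Z"
      using Z_refl[OF d, of "refl d \<eta>"] \<eta>(3) by (auto simp: root_norm basis_root[OF d])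
    then show ?case
      using pos basis_word_closed[OF ds] basis_root[OF d] by (simp add: act_refl_elt \<eta>_def)
  qed
  obtain ds where ds: "ds \<in> lists basis" "refl_elt \<beta> = word_val G (map refl_elt ds)"
    using generated_word[OF refl_elt_generated[OF \<beta>(1)]] by metis
  have "\<phi> (refl_elt \<beta>) \<beta> \<in> \<Phi>neg"
    using reflection_self_neg[OF \<beta>(2)] sub_root[OF \<beta>(1)] by (simp add: act_refl_elt)
  then show False using stay[OF ds(1)] ds(2) pos_neg_disjoint by auto
qed

text \<open>An element fixing the canonical basis has no descent, so it is trivial; hence \<open>w\<close> is
  determined by the images of the basis.\<close>

lemma finite_of_finite_subsystem:
  assumes fin: "finite \<Psi>"
  shows "finite (generate G gens)"
proof -
  have trivial: "u = \<one>" if u: "u \<in> generate G gens" and fix_basis: "\<And>d. d \<in> basis \<Longrightarrow> \<phi> u d = d" for u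
  proof -
    obtain ds where ds: "ds \<in> lists basis" "u = word_val G (map refl_elt ds)" "length ds = rlen u"
      by (rule generated_word[OF u])
    show ?thesis
    proof (cases ds rule: rev_cases)
      case Nil
      then show ?thesis using ds by simp
    next
      case (snoc es d)
      then have d: "d \<in> basis" and es: "es \<in> lists basis" using ds by auto
      have gens: "map refl_elt es \<in> lists gens" "map refl_elt [d] \<in> lists gens" using d es by auto
      have "u \<otimes> refl_elt d = word_val G (map refl_elt es)"
        using ds(2) snoc word_val_append[OF gens gens_subset] basis_word_closed[OF es]
          mult_basis_twice[OF basis_word_closed[OF es] d] basis_root[OF d] by simp
      then have "rlen (u \<otimes> refl_elt d) \<le> length es"
        using word_length_le[OF gens(1)] by simp
      moreover have "rlen u < rlen (u \<otimes> refl_elt d)"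
        using rlen_ascent[OF u d] fix_basis[OF d] basis_pos[OF d] by simp
      ultimately show ?thesis using ds(3) snoc by simp
    qed
  qed
  define f where "f w = (\<lambda>d\<in>basis. \<phi> w d)" for w
  have finb: "finite basis"
    using fin basis_mem by (meson finite_subset subsetI)
  have "f ` generate G gens \<subseteq> basis \<rightarrow>\<^sub>E \<Psi>"
    using generated_act basis_mem by (auto simp: f_def)
  moreover have "finite (basis \<rightarrow>\<^sub>E \<Psi>)" by (rule finite_PiE[OF finb]) (rule fin)
  ultimately have "finite (f ` generate G gens)" using finite_subset by blast
  moreover have "inj_on f (generate G gens)"
  proof (rule inj_onI)
    fix v w assume v: "v \<in> generate G gens" and w: "w \<in> generate G gens" and eq: "f v = f w"
    have "\<phi> v d = \<phi> w d" if "d \<in> basis" for d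
      using fun_cong[OF eq, of d] that by (simp add: f_def)
    then have "inv w \<otimes> v = \<one>"
      using trivial[OF generated_mult[OF generated_inv[OF w] v]]
        generated_carrier[OF v] generated_carrier[OF w] by simp
    then show "v = w"
      using generated_carrier[OF v] generated_carrier[OF w]
      by (metis inv_closed inv_equality inv_inv)
  qed
  ultimately show ?thesis using finite_imageD by blast
qed

text \<open>At the first index where the chain coefficient fails to be positive, either it vanishes and
  the chain closes up, so that the root system is finite; or it is strictly negative, and the
  chain continues through positive roots to one with two negative coefficients.\<close>

lemma infinite_dihedral_product:
  assumes basis: "basis = {x, y}" and xy: "x \<noteq> y" and inf: "infinite \<Psi>"
  shows "B x y \<le> -1"
proof (rule ccontr)
  assume nle: "\<not> B x y \<le> -1"
  define q where "q = - 2 * B x y"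
  have xb: "x \<in> basis" and yb: "y \<in> basis" using basis by auto
  have q0: "q \<ge> 0" using basis_obtuse[OF xb yb xy] by (simp add: q_def)
  have cx: "chain B x y n = cheb q (Suc n) *\<^sub>R x + cheb q n *\<^sub>R y" for n
    by (simp add: chain_def q_def)
  have cy: "chain B y x n = cheb q (Suc n) *\<^sub>R y + cheb q n *\<^sub>R x" for n
    using B_symmetric[of y x] by (simp add: chain_def q_def)
  define N where "N = (LEAST n. cheb q (Suc n) \<le> 0)"
  have "\<exists>n. cheb q (Suc n) \<le> 0" using cheb_nonpos_exists nle by (simp add: q_def)
  then have N: "cheb q (Suc N) \<le> 0" unfolding N_def by (rule LeastI_ex)
  have before: "cheb q (Suc n) > 0" if "n < N" for n
    using not_less_Least[of n "\<lambda>n. cheb q (Suc n) \<le> 0"] that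
    unfolding N_def by (simp only: not_le)
  obtain m where m: "N = Suc m" using N by (cases N) auto
  have um: "cheb q N > 0" using before[of m] m by simp
  have um': "cheb q m \<ge> 0"
  proof (cases m)
    case (Suc i)
    then show ?thesis using before[of i] m by simp
  qed simp
  show False
  proof (cases "cheb q (Suc N) = 0")
    case True
    have "chain B x y N = cheb q N *\<^sub>R y" by (simp add: cx True)
    then have "B (cheb q N *\<^sub>R y) (cheb q N *\<^sub>R y) = 1"
      using root_norm[OF chain_root[OF basis_root[OF xb] basis_root[OF yb], of N]] by simp
    then have "cheb q N * cheb q N = 1"
      using root_norm[OF basis_root[OF yb]] by (simp add: B_simps)
    then have one: "cheb q N = 1"
      using um by (metis abs_of_pos abs_square_eq_1 power2_eq_square)
    note period = cheb_antiperiodic[OF True one]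
    have fold: "chain B x y (Suc N + j) = - chain B x y j"
        "chain B y x (Suc N + j) = - chain B y x j" for j
      using period[of j] period[of "Suc j"] unfolding cx cy by simp_all
    define F where "F = (\<Union>n\<in>{..N}. {chain B x y n, chain B y x n, - chain B x y n, - chain B y x n})"
    have mem: "{chain B x y n, chain B y x n, - chain B x y n, - chain B y x n} \<subseteq> F" for n
    proof (induction n rule: less_induct)
      case (less n)
      show ?case
      proof (cases "n \<le> N")
        case True
        then show ?thesis unfolding F_def by blast
      next
        case False
        define j where "j = n - Suc N"
        have n: "n = Suc N + j" "j < n" using False by (auto simp: j_def)
        show ?thesis using less[OF n(2)] unfolding n(1) fold by auto
      qed
    qed
    have "\<Psi> \<subseteq> F" using dihedral_root_in_chain[OF basis] mem by blast
    moreover have "finite F" unfolding F_def by auto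
    ultimately show False using inf finite_subset by blast
  next
    case False
    then have neg: "cheb q (Suc N) < 0" using N by simp
    note mx = basis_mem[OF xb] and my = basis_mem[OF yb]
    have root: "chain B y x n \<in> \<Phi>" "chain B x y n \<in> \<Phi>" for n
      using chain_root basis_root xb yb by auto
    \<comment> \<open>Apply \<open>s\<^sub>x\<close> and then \<open>s\<^sub>y\<close> to the last member with non-negative coefficients.\<close>
    have p1: "chain B y x m \<in> \<Phi>pos"
      using root(1)[of m] um um' m pos_comb[OF _ basis_pos[OF yb] basis_pos[OF xb]]
      unfolding cy by simp
    have n1: "chain B y x m \<noteq> x"
    proof
      assume "chain B y x m = x"
      then have "cheb q N *\<^sub>R y = (1 - cheb q m) *\<^sub>R x"
        unfolding cy m by (simp add: algebra_simps)
      from basis_not_proportional[OF yb xb xy[symmetric] this] show False using um by simp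
    qed
    have p2: "chain B x y N \<in> \<Phi>pos"
      using basis_reflection_pos[OF xb chain_mem[OF my mx] p1 n1]
        reflection_chain[OF root_norm[OF basis_root[OF xb]], of y m] m by simp
    have n2: "chain B x y N \<noteq> y"
    proof
      assume "chain B x y N = y"
      then have "cheb q (Suc N) *\<^sub>R x = (1 - cheb q N) *\<^sub>R y"
        unfolding cx by (simp add: algebra_simps)
      from basis_not_proportional[OF xb yb xy this] show False using neg by simp
    qed
    have p3: "chain B y x (Suc N) \<in> \<Phi>pos"
      using basis_reflection_pos[OF yb chain_mem[OF mx my] p2 n2]
        reflection_chain[OF root_norm[OF basis_root[OF yb]], of x N] by simp
    have "q * cheb q (Suc N) \<le> 0" using q0 neg by (simp add: mult_nonneg_nonpos)
    then have "cheb q (Suc (Suc N)) < 0" using um by simp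
    then have "- chain B y x (Suc N) \<in> pos_cone"
      using pos_cone_comb[of y x "- cheb q (Suc (Suc N))" "- cheb q (Suc N)"] neg
        pos_root_cone basis_pos[OF xb] basis_pos[OF yb]
      unfolding cy by (simp add: algebra_simps del: cheb.simps)
    then show False
      using p3 root_nonzero pos_cone_pointed by (metis pos_root_iff)
  qed
qed

lemma rlen_basis_eq: "a \<in> basis \<Longrightarrow> rlen (refl_elt a) = 1"
  using rlen_ascent[of \<one> a] rlen_basis[of a] basis_pos[of a] basis_root[of a] generate.one
  by fastforce

text \<open>The members of the chain starting with \<open>x\<close> have product at most \<open>-1\<close> with \<open>y\<close>, because
  \<open>B(x, y) \<le> -1\<close> and the coefficient of \<open>x\<close> exceeds that of \<open>y\<close> by at least one.  So \<open>s\<^sub>y\<close> carries them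
  to the next level of the other chain, raising both the length and the depth.\<close>

lemma chain_rise:
  assumes x: "x \<in> basis" and y: "y \<in> basis" and k: "B x y \<le> -1"
  shows "B y (chain B x y n) \<le> -1"
    and "depth (chain B x y n) < depth (chain B y x (Suc n))"
    and "rlen (refl_elt (chain B y x (Suc n))) = rlen (refl_elt (chain B x y n)) + 2"
proof -
  define q where "q = - 2 * B x y"
  have q: "q \<ge> 2" using k by (simp add: q_def)
  note inc = cheb_increasing[OF q, of n]
  have yy: "B y y = 1" by (rule root_norm[OF basis_root[OF y]])
  have "B y (chain B x y n) = B x y * cheb q (Suc n) + cheb q n"
    using B_symmetric[of y x] yy by (simp add: chain_def B_simps q_def)
  moreover have "B x y * cheb q (Suc n) \<le> -1 * cheb q (Suc n)"
    using k inc by (intro mult_right_mono) auto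
  ultimately show le: "B y (chain B x y n) \<le> -1" using inc by linarith
  have pos: "chain B x y n \<in> \<Phi>pos" by (rule chain_pos[OF basis_pos[OF x] basis_pos[OF y] k])
  have eq: "chain B y x (Suc n) = refl y (chain B x y n)"
    by (rule reflection_chain[OF yy, symmetric])
  show "depth (chain B x y n) < depth (chain B y x (Suc n))"
    unfolding eq
    by (rule depth_reflection_strict[OF basis_pos[OF y] pos _ dominates_neg[OF basis_pos[OF y] pos le]])
       (use le in simp)
  show "rlen (refl_elt (chain B y x (Suc n))) = rlen (refl_elt (chain B x y n)) + 2"
    unfolding eq
    by (rule rlen_reflection_rise[OF y chain_mem[OF basis_mem[OF x] basis_mem[OF y]] pos])
       (use le in simp)
qed

lemma chain_rlen:
  "x \<in> basis \<Longrightarrow> y \<in> basis \<Longrightarrow> B x y \<le> -1 \<Longrightarrow> rlen (refl_elt (chain B x y n)) = 2 * n + 1"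
proof (induction n arbitrary: x y)
  case (Suc n)
  then show ?case using chain_rise(3)[of y x n] B_symmetric[of y x] by simp
qed (simp add: rlen_basis_eq)

lemma chain_depth_less:
  assumes x: "x \<in> basis" and y: "y \<in> basis" and k: "B x y \<le> -1" and ij: "i < j"
  shows "depth (chain B x y i) < depth (chain B x y j)"
    and "depth (chain B x y i) < depth (chain B y x j)"
proof -
  have same: "depth (chain B x y i) < depth (chain B x y j)"
    if "x \<in> basis" "y \<in> basis" "B x y \<le> -1" "i < j" for x y i j
  proof -
    have "depth (chain B x y n) < depth (chain B x y (Suc n))" for n
    proof (rule depth_dominates_strict)
      show "chain B x y (Suc n) \<noteq> chain B x y n"
        using chain_rlen[OF that(1-3), of n] chain_rlen[OF that(1-3), of "Suc n"] by auto
    qed (use chain_pos chain_dominates basis_pos that in auto)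
    then show ?thesis using lift_Suc_mono_less[of "\<lambda>n. depth (chain B x y n)"] that(4) by blast
  qed
  show "depth (chain B x y i) < depth (chain B x y j)" by (rule same[OF x y k ij])
  have "depth (chain B x y i) < depth (chain B y x (Suc i))" by (rule chain_rise(2)[OF x y k])
  moreover have "depth (chain B y x (Suc i)) \<le> depth (chain B y x j)"
    using same[OF y x, of "Suc i" j] k B_symmetric[of y x] ij by (cases "Suc i = j") auto
  ultimately show "depth (chain B x y i) < depth (chain B y x j)" by simp
qed

lemma infinite_dihedral_depth:
  assumes basis: "basis = {x, y}" and xy: "x \<noteq> y" and inf: "infinite (generate G gens)"
    and \<gamma>: "\<gamma> \<in> \<Psi>" "\<gamma> \<in> \<Phi>pos" and \<delta>: "\<delta> \<in> \<Psi>" "\<delta> \<in> \<Phi>pos"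
    and less: "rlen (refl_elt \<gamma>) < rlen (refl_elt \<delta>)"
  shows "depth \<gamma> < depth \<delta>"
proof -
  have xb: "x \<in> basis" and yb: "y \<in> basis" using basis by auto
  have k: "B x y \<le> -1"
    using infinite_dihedral_product[OF basis xy] finite_of_finite_subsystem inf by blast
  then have k': "B y x \<le> -1" using B_symmetric by simp
  have pos: "chain B x y n \<in> \<Phi>pos" "chain B y x n \<in> \<Phi>pos" for n
    using chain_pos basis_pos xb yb k k' by auto
  have ex: "\<exists>n. \<beta> = chain B x y n \<or> \<beta> = chain B y x n" if "\<beta> \<in> \<Psi>" "\<beta> \<in> \<Phi>pos" for \<beta>
    using dihedral_root_in_chain[OF basis that(1)] pos pos_neg_disjoint[OF that(2)]
    by (auto simp: neg_root_iff)
  obtain i where i: "\<gamma> = chain B x y i \<or> \<gamma> = chain B y x i" using ex[OF \<gamma>] by blast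
  obtain j where j: "\<delta> = chain B x y j \<or> \<delta> = chain B y x j" using ex[OF \<delta>] by blast
  have "rlen (refl_elt \<gamma>) = 2 * i + 1" "rlen (refl_elt \<delta>) = 2 * j + 1"
    using i j chain_rlen[OF xb yb k] chain_rlen[OF yb xb k'] by auto
  then have ij: "i < j" using less by simp
  show ?thesis
    using i j chain_depth_less[OF xb yb k ij] chain_depth_less[OF yb xb k' ij] by auto
qed

end

section \<open>Reflection subgroups and their root systems\<close>

context coxeter_geometry
begin

lemma
  assumes W': "reflection_subgroup G \<phi> S B \<alpha> W'"
  shows reflection_subsystem_sub_roots: "reflection_subsystem G S \<phi> B \<alpha> (sub_roots G \<phi> S B \<alpha> W')"
    and sub_simple_roots_eq:
      "sub_simple_roots G \<phi> S B \<alpha> W' = canonical_basis (sub_roots G \<phi> S B \<alpha> W')"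
    and reflection_subgroup_eq:
      "W' = generate G (refl_elt ` canonical_basis (sub_roots G \<phi> S B \<alpha> W'))"
proof -
  define \<Psi> where "\<Psi> = sub_roots G \<phi> S B \<alpha> W'"
  obtain R where R: "R \<subseteq> \<Phi>" "W' = generate G (refl_elt ` R)"
    using W' unfolding reflection_subgroup_def by blast
  have \<Psi>: "\<beta> \<in> \<Psi> \<longleftrightarrow> \<beta> \<in> \<Phi> \<and> refl_elt \<beta> \<in> W'" for \<beta>
    by (auto simp: \<Psi>_def sub_roots_def)
  have sub: "subsystem \<Psi>"
    unfolding subsystem_def
  proof (intro conjI ballI subsetI)
    fix \<beta> \<gamma> assume "\<beta> \<in> \<Psi>" "\<gamma> \<in> \<Psi>"
    then have *: "\<beta> \<in> \<Phi>" "\<gamma> \<in> \<Phi>" "refl_elt \<beta> \<in> W'" "refl_elt \<gamma> \<in> W'" by (auto simp: \<Psi>)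
    then have "refl_elt (refl \<beta> \<gamma>) \<in> W'"
      using refl_elt_reflection[OF *(1,2)] R(2) generate.eng by metis
    then show "refl \<beta> \<gamma> \<in> \<Psi>" using * reflection_root by (simp add: \<Psi>)
  qed (simp add: \<Psi>)
  then interpret reflection_subsystem G S \<phi> B \<alpha> \<Psi> by unfold_locales
  show "reflection_subsystem G S \<phi> B \<alpha> (sub_roots G \<phi> S B \<alpha> W')"
    using reflection_subsystem_axioms by (simp add: \<Psi>_def)
  have inv_set: "\<eta> \<in> inversion_set G \<phi> S \<alpha> (refl_elt \<beta>) \<longleftrightarrow> \<eta> \<in> \<Phi>pos \<and> refl \<beta> \<eta> \<in> \<Phi>neg"
    if "\<beta> \<in> \<Phi>" for \<beta> \<eta>
    using inversion_iff[of "refl_elt \<beta>"] that by (simp add: refl_elt_inv act_refl_elt)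
  have "\<beta> \<in> sub_simple_roots G \<phi> S B \<alpha> W' \<longleftrightarrow> \<beta> \<in> canonical_basis \<Psi>" for \<beta>
  proof (cases "\<beta> \<in> \<Phi>pos")
    case True
    note \<beta> = pos_root_root[OF True]
    have "\<beta> \<in> sub_simple_roots G \<phi> S B \<alpha> W' \<longleftrightarrow>
        {\<eta> \<in> \<Psi> \<inter> \<Phi>pos. refl \<beta> \<eta> \<in> \<Phi>neg} = {\<beta>}"
      using True inv_set[OF \<beta>] unfolding sub_simple_roots_def \<Psi>_def
      by (simp add: set_eq_iff) blast
    also have "\<dots> \<longleftrightarrow> \<beta> \<in> canonical_basis \<Psi>"
      using True reflection_self_neg[OF True] unfolding canonical_basis_def by blast
    finally show ?thesis .
  next
    case False
    then show ?thesis unfolding sub_simple_roots_def canonical_basis_def by simp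
  qed
  then show "sub_simple_roots G \<phi> S B \<alpha> W' = canonical_basis (sub_roots G \<phi> S B \<alpha> W')"
    by (auto simp: \<Psi>_def)
  have "W' = generate G gens"
  proof
    have "refl_elt ` R \<subseteq> generate G gens"
    proof
      fix x assume "x \<in> refl_elt ` R"
      then obtain \<beta> where "\<beta> \<in> R" "x = refl_elt \<beta>" by blast
      moreover from this have "\<beta> \<in> \<Psi>" using R by (auto simp: \<Psi> intro: generate.incl)
      ultimately show "x \<in> generate G gens" using refl_elt_generated by simp
    qed
    then show "W' \<subseteq> generate G gens"
      unfolding R(2) using generate_subgroup_incl[OF _ generate_is_subgroup[OF gens_subset]] by blast
    have "gens \<subseteq> W'" using basis_mem by (auto simp: \<Psi>)
    moreover have "subgroup W' G"
      unfolding R(2) by (rule generate_is_subgroup) (use R in auto)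
    ultimately show "generate G gens \<subseteq> W'" by (rule generate_subgroup_incl)
  qed
  then show "W' = generate G (refl_elt ` canonical_basis (sub_roots G \<phi> S B \<alpha> W'))"
    by (simp add: \<Psi>_def)
qed

end

theorem proposition5p4:
  fixes G :: "('g, 'm) monoid_scheme"
    and S W' :: "'g set"
    and \<phi> :: "'g \<Rightarrow> 'v::real_vector \<Rightarrow> 'v"
    and B :: "'v \<Rightarrow> 'v \<Rightarrow> real"
    and \<alpha> :: "'g \<Rightarrow> 'v"
    and \<gamma> \<delta> :: 'v
  assumes "coxeter_system G S"
    and "finite S"
    and "geometric_representation G \<phi> S B \<alpha>"
    and "dihedral_reflection_subgroup G \<phi> S B \<alpha> W'"
    and "\<gamma> \<in> sub_pos_roots G \<phi> S B \<alpha> W'"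
    and "\<delta> \<in> sub_pos_roots G \<phi> S B \<alpha> W'"
  shows
    "(infinite W' \<and>
        sub_length G \<phi> S B \<alpha> W' (root_reflection G \<phi> B \<gamma>)
          < sub_length G \<phi> S B \<alpha> W' (root_reflection G \<phi> B \<delta>)
      \<longrightarrow> inf_depth G \<phi> S \<alpha> \<gamma> < inf_depth G \<phi> S \<alpha> \<delta>)
    \<and> (finite W' \<and>
        (\<exists>x\<in>W'. \<delta> = \<phi> x \<gamma> \<and>
          sub_length G \<phi> S B \<alpha> W' (root_reflection G \<phi> B \<delta>)
            = sub_length G \<phi> S B \<alpha> W' (root_reflection G \<phi> B \<gamma>)
              + 2 * sub_length G \<phi> S B \<alpha> W' x)
      \<longrightarrow> inf_depth G \<phi> S \<alpha> \<gamma> \<le> inf_depth G \<phi> S \<alpha> \<delta>)"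
proof -
  interpret coxeter_geometry G S \<phi> B \<alpha>
    using assms(1,3) by (rule coxeter_geometry.intro)
  have W': "reflection_subgroup G \<phi> S B \<alpha> W'"
    and card: "card (sub_simple_roots G \<phi> S B \<alpha> W') = 2"
    using assms(4) by (auto simp: dihedral_reflection_subgroup_def)
  interpret reflection_subsystem G S \<phi> B \<alpha> "sub_roots G \<phi> S B \<alpha> W'"
    by (rule reflection_subsystem_sub_roots[OF W'])
  note gen = reflection_subgroup_eq[OF W']
  have len: "sub_length G \<phi> S B \<alpha> W' = rlen"
    by (simp add: sub_length_def sub_simple_roots_eq[OF W'])
  obtain a b where ab: "basis = {a, b}" "a \<noteq> b"
    using card unfolding sub_simple_roots_eq[OF W'] card_2_iff by blast
  note roots = assms(5,6)[unfolded sub_pos_roots_def, THEN IntD1]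
    assms(5,6)[unfolded sub_pos_roots_def, THEN IntD2]
  show ?thesis
    unfolding len
  proof (intro conjI impI; elim conjE bexE)
    assume "infinite W'" "rlen (refl_elt \<gamma>) < rlen (refl_elt \<delta>)"
    then show "depth \<gamma> < depth \<delta>"
      using infinite_dihedral_depth[OF ab _ roots(1,3,2,4)] gen by simp
  next
    fix x assume x: "x \<in> W'" and \<delta>: "\<delta> = \<phi> x \<gamma>"
      and add: "rlen (refl_elt \<delta>) = rlen (refl_elt \<gamma>) + 2 * rlen x"
    obtain ds where ds: "ds \<in> lists basis" "x = word_val G (map refl_elt ds)" "length ds = rlen x"
      using generated_word[of x] x gen by metis
    show "depth \<gamma> \<le> depth \<delta>"
      using depth_mono_of_additive[OF ds(1) roots(1,3)] add ds \<delta> by simp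
  qed
qed

end
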